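(* Let $Y$ be a (real) Banach space whose norm $|\cdot|$ belongs to $C^1(Y\setminus\{0\})$ and let $X\subset Y$ be a closed subset with finite doubling constant $\lambda$. Given two continuous functions $f:X\to\mathbb R$ and $L:X\to Y^*$, $x\mapsto L_x$, define the remainder \[ R(x,y)=f(y)-f(x)-L_x(y-x)\qquad\text{for } x,y\in X,\ x\ne y, \] and assume that the function $(x,y)\mapsto \dfrac{R(x,y)}{|y-x|}$ can be extended to a continuous function on $X\times X$ that takes the value $0$ where $y=x$. Then there exists an extension $\tilde f\in C^1(Y)$ of $f$ (i.e. $\tilde f|_X=f$) such that $d\tilde f_x=L_x$ for all $x\in X$. Moreover, the extension operator $(f,L)\mapsto\tilde f$ is linear; that is, $\tilde f$ can be chosen, for all pairs $(f,L)$ of continuous functions $f:X\to\mathbb R$ and $L:X\to Y^*$ such that the function $(x,y)\mapsto \dfrac{f(y)-f(x)-L_x(y-x)}{|y-x|}$, defined for $x,y\in X$, $x\ne y$, can be extended to a continuous function on $X\times X$ that takes the value $0$ where $y=x$, in such a way that $(f,L)\mapsto\tilde f$ is a linear map on the vector space of such pairs.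
   Context: $Y^*$ is the topological dual of $Y$ with the dual norm, and continuity of $L$ is with respect to this norm. $C^1(Y)$ is the space of real-valued continuously (Fréchet) differentiable functions on $Y$; $d\tilde f_x\in Y^*$ is the differential at $x$. A metric space $X$ is doubling if there is $\lambda\in\mathbb N$ such that for every $r>0$ every (open) ball of radius $2r$ in $X$ can be covered by at most $\lambda$ balls of radius $r$ in $X$; the least such $\lambda$ is the doubling constant of $X$. The subset $X\subset Y$ carries the metric $|x-y|$. *)

theory Defs
  imports "HOL-Analysis.Analysis"
begin

text \<open>
  The dual space \<open>Y\<^sup>*\<close> is the type \<open>'a \<Rightarrow>\<^sub>L real\<close> of bounded linear functionals, which carries
  the operator norm.
\<close>

text \<open>Meant for open \<open>U\<close>: \<open>at x\<close> is the full neighbourhood filter, so \<open>D x\<close> is the Frechet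
  differential at \<open>x\<close>, and \<open>D\<close> is continuous for the dual norm.\<close>

definition C1_on :: "'a::real_normed_vector set \<Rightarrow> ('a \<Rightarrow> real) \<Rightarrow> bool" where
  "C1_on U f \<longleftrightarrow> (\<exists>D :: 'a \<Rightarrow> ('a \<Rightarrow>\<^sub>L real).
     (\<forall>x\<in>U. (f has_derivative blinfun_apply (D x)) (at x)) \<and> continuous_on U D)"

text \<open>\<open>X\<close> is regarded as a metric space of its own: its balls are the sets \<open>X \<inter> ball c r\<close> with centre
  \<open>c\<close> in \<open>X\<close>. A cover by at most \<open>N\<close> balls of the fixed radius \<open>r\<close> is given by its set \<open>C\<close> of centres.\<close>

definition doubling :: "'a::metric_space set \<Rightarrow> bool" where
  "doubling X \<longleftrightarrow> (\<exists>N::nat. \<forall>r>0. \<forall>x\<in>X. \<exists>C\<subseteq>X. finite C \<and> card C \<le> N \<and>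
     X \<inter> ball x (2 * r) \<subseteq> (\<Union>c\<in>C. X \<inter> ball c r))"

definition remainder ::
  "('a::real_normed_vector \<Rightarrow> real) \<Rightarrow> ('a \<Rightarrow> ('a \<Rightarrow>\<^sub>L real)) \<Rightarrow> 'a \<Rightarrow> 'a \<Rightarrow> real" where
  "remainder f L x y = f y - f x - blinfun_apply (L x) (y - x)"

text \<open>Functions on \<open>X\<close> are represented by total functions whose values outside \<open>X\<close> are irrelevant.\<close>

definition admissible_pair ::
  "'a::real_normed_vector set \<Rightarrow> ('a \<Rightarrow> real) \<Rightarrow> ('a \<Rightarrow> ('a \<Rightarrow>\<^sub>L real)) \<Rightarrow> bool" where
  "admissible_pair X f L \<longleftrightarrow> continuous_on X f \<and> continuous_on X L \<and>
     (\<exists>g :: 'a \<times> 'a \<Rightarrow> real. continuous_on (X \<times> X) g \<and>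
        (\<forall>x\<in>X. \<forall>y\<in>X. x \<noteq> y \<longrightarrow> g (x, y) = remainder f L x y / norm (y - x)) \<and>
        (\<forall>x\<in>X. g (x, x) = 0))"

definition C1_extension ::
  "'a::real_normed_vector set \<Rightarrow> ('a \<Rightarrow> real) \<Rightarrow> ('a \<Rightarrow> ('a \<Rightarrow>\<^sub>L real)) \<Rightarrow> ('a \<Rightarrow> real) \<Rightarrow> bool" where
  "C1_extension X f L F \<longleftrightarrow> C1_on UNIV F \<and> (\<forall>x\<in>X. F x = f x) \<and>
     (\<forall>x\<in>X. (F has_derivative blinfun_apply (L x)) (at x))"

text \<open>The first conjunct makes \<open>E\<close> a well-defined map on pairs of functions on \<open>X\<close>: it may not see the
  values outside \<open>X\<close> of the representing total functions. The other two are linearity of that map.\<close>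

definition linear_on_pairs ::
  "'a::real_normed_vector set \<Rightarrow> (('a \<Rightarrow> real) \<Rightarrow> ('a \<Rightarrow> ('a \<Rightarrow>\<^sub>L real)) \<Rightarrow> 'a \<Rightarrow> real) \<Rightarrow> bool" where
  "linear_on_pairs X E \<longleftrightarrow>
     (\<forall>f L f' L'. admissible_pair X f L \<longrightarrow> admissible_pair X f' L' \<longrightarrow>
        (\<forall>x\<in>X. f x = f' x \<and> L x = L' x) \<longrightarrow> E f L = E f' L') \<and>
     (\<forall>f L f' L'. admissible_pair X f L \<longrightarrow> admissible_pair X f' L' \<longrightarrow>
        E (\<lambda>x. f x + f' x) (\<lambda>x. L x + L' x) = (\<lambda>y. E f L y + E f' L' y)) \<and>
     (\<forall>c::real. \<forall>f L. admissible_pair X f L \<longrightarrow>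
        E (\<lambda>x. c * f x) (\<lambda>x. c *\<^sub>R L x) = (\<lambda>y. c * E f L y))"

end

theory Submission
  imports Defs
begin

text \<open>
  The extension is of Whitney's type. Off \<open>X\<close> it is \<open>F y = (\<Sum>j. v j y * T j y)\<close>, where
  \<open>T j y = f (p j) + L (p j) (y - p j)\<close> is the first order Taylor polynomial at a point \<open>p j\<close> of \<open>X\<close> and \<open>v\<close> is a \<open>C\<^sup>1\<close> partition of unity on the complement
  of \<open>X\<close>. For a fixed partition this formula is linear in \<open>(f, L)\<close>. Everything depends on a partition
  with the following properties: if \<open>d\<close> is the distance of \<open>y\<close> from \<open>X\<close>, then near \<open>y\<close> only finitely
  many \<open>v j\<close> are nonzero, their points \<open>p j\<close> are within \<open>C d\<close> of \<open>y\<close>, and the norms of their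
  differentials at \<open>y\<close> add up to at most \<open>C / d\<close> (\<open>whitney_partition\<close>).

  The usual construction covers the complement of \<open>X\<close> by Whitney cubes or balls, which have no
  bounded overlap when \<open>Y\<close> is infinite dimensional. Here the partition is indexed by points of the
  doubling set \<open>X\<close> instead: for each scale \<open>2\<^sup>n\<close> choose a maximal \<open>2\<^sup>n\<close>-separated net in \<open>X\<close>, and
  attach to each net point a bump of radius \<open>4 * 2\<^sup>n\<close>, a function of the norm and therefore \<open>C\<^sup>1\<close> off
  its centre. The bumps of
  scale \<open>n\<close> have to be switched off at points that are much closer to \<open>X\<close> than \<open>2\<^sup>n\<close>. The distance to
  \<open>X\<close> is not differentiable in general, so it cannot be used for this purpose; the sum of the bumps of scale
  \<open>n - 2\<close> serves as a substitute, for it is at least \<open>1\<close> close to \<open>X\<close> and vanishes far away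
  (\<open>density_ge_1\<close>, \<open>density_eq_0\<close>). After this cut-off a point at distance \<open>d\<close> sees only scales
  comparable with \<open>d\<close>, and doubling bounds the number of net points that it sees
  (\<open>doubling_separated_card\<close>). Dividing by the total weight gives the partition
  (\<open>whitney_partition_of_nets\<close>).

  Near \<open>a \<in> X\<close> the assumption on the remainder says that Taylor polynomials at points \<open>x\<close>, \<open>x'\<close> of \<open>X\<close>
  differ at \<open>y\<close> by at most \<open>\<epsilon> * (\<bar>x - x'\<bar> + \<bar>x - y\<bar>)\<close> (\<open>jet_modulus_taylor\<close>). For the points \<open>p j\<close> active at
  \<open>y\<close> this is \<open>O(\<epsilon> d)\<close>, which compensates the factor \<open>1 / d\<close> in the differentials of the partition.
  So \<open>F\<close> has differential \<open>L a\<close> at \<open>a\<close> (\<open>extension_value_estimate\<close>) and its differential is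
  continuous there (\<open>extension_differential_estimate\<close>).
\<close>

section \<open>Differentials of continuously differentiable functions\<close>

text \<open>
  The Frechet differential as an element of the dual space. Having it as a function turns the
  calculus of \<open>C\<^sup>1\<close> functions into equations, from which bounds on its norm can be read off.
\<close>

definition differential :: "('a::real_normed_vector \<Rightarrow> real) \<Rightarrow> 'a \<Rightarrow> ('a \<Rightarrow>\<^sub>L real)" where
  "differential f x = Blinfun (frechet_derivative f (at x))"

lemma differential_eqI:
  assumes "(f has_derivative blinfun_apply D) (at x)"
  shows "differential f x = D"
  using frechet_derivative_at[OF assms] by (metis blinfun_apply_inverse differential_def)

lemma C1_on_has_differential:
  assumes "C1_on U f" "x \<in> U"
  shows "(f has_derivative blinfun_apply (differential f x)) (at x)"
  using assms differential_eqI unfolding C1_on_def by metis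

lemma C1_on_continuous_differential:
  assumes "C1_on U f"
  shows "continuous_on U (differential f)"
proof -
  obtain D where "\<forall>x\<in>U. (f has_derivative blinfun_apply (D x)) (at x)" "continuous_on U D"
    using assms unfolding C1_on_def by blast
  then show ?thesis
    using continuous_on_eq differential_eqI by metis
qed

lemma C1_on_continuous:
  assumes "C1_on U f"
  shows "continuous_on U f"
proof (rule continuous_at_imp_continuous_on, rule ballI)
  fix x assume "x \<in> U"
  then show "isCont f x"
    using C1_on_has_differential[OF assms] has_derivative_continuous by blast
qed

lemma C1_onI:
  assumes "\<And>x. x \<in> U \<Longrightarrow> (f has_derivative blinfun_apply (D x)) (at x)" "continuous_on U D"
  shows "C1_on U f"
  using assms unfolding C1_on_def by blast

lemma C1_on_subset: "C1_on U f \<Longrightarrow> V \<subseteq> U \<Longrightarrow> C1_on V f"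
  unfolding C1_on_def by (meson continuous_on_subset subsetD)

lemma C1_on_cong_open:
  assumes "C1_on V f" "open V" "\<And>x. x \<in> V \<Longrightarrow> f x = g x"
  shows "C1_on V g"
  using assms unfolding C1_on_def by (meson has_derivative_transform_within_open)

lemma differential_cong_open:
  assumes "C1_on V f" "open V" "\<And>x. x \<in> V \<Longrightarrow> f x = g x" "x \<in> V"
  shows "differential g x = differential f x"
  by (metis C1_on_has_differential[OF assms(1,4)] assms differential_eqI
      has_derivative_transform_within_open)

lemma C1_on_local:
  assumes "\<And>x. x \<in> U \<Longrightarrow> \<exists>V. open V \<and> x \<in> V \<and> C1_on V f"
  shows "C1_on U f"
proof (rule C1_onI)
  show "(f has_derivative blinfun_apply (differential f x)) (at x)" if "x \<in> U" for x
    using assms[OF that] C1_on_has_differential by blast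
  show "continuous_on U (differential f)"
  proof (rule continuous_at_imp_continuous_on, rule ballI)
    fix x assume "x \<in> U"
    then obtain V where "open V" "x \<in> V" "C1_on V f" using assms by blast
    then show "isCont (differential f) x"
      using C1_on_continuous_differential continuous_on_eq_continuous_at by blast
  qed
qed

lemma has_derivative_affine:
  "((\<lambda>y. c + blinfun_apply l (y - a)) has_derivative blinfun_apply l) (at x)"
  by (auto intro!: derivative_eq_intros simp: blinfun.diff_right)

lemma C1_on_affine: "C1_on U (\<lambda>y. c + blinfun_apply l (y - a))"
  by (rule C1_onI[where D = "\<lambda>_. l"]) (auto intro: has_derivative_affine)

lemma differential_affine: "differential (\<lambda>y. c + blinfun_apply l (y - a)) x = l"
  by (rule differential_eqI) (rule has_derivative_affine)

lemma differential_const: "differential (\<lambda>_. c) x = 0"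
  by (rule differential_eqI) (simp add: zero_blinfun.rep_eq)

lemma has_derivative_mult_blinfun:
  assumes "C1_on U f" "C1_on U g" "x \<in> U"
  shows "((\<lambda>y. f y * g y) has_derivative
    blinfun_apply (f x *\<^sub>R differential g x + g x *\<^sub>R differential f x)) (at x)"
  using C1_on_has_differential[OF assms(1,3)] C1_on_has_differential[OF assms(2,3)]
  by (auto intro!: derivative_eq_intros simp: blinfun.add_left blinfun.scaleR_left mult.commute)

lemma C1_on_mult:
  assumes "C1_on U f" "C1_on U g"
  shows "C1_on U (\<lambda>y. f y * g y)"
  by (rule C1_onI[OF has_derivative_mult_blinfun[OF assms]], assumption)
    (intro continuous_intros C1_on_continuous[OF assms(1)] C1_on_continuous[OF assms(2)]
      C1_on_continuous_differential[OF assms(1)] C1_on_continuous_differential[OF assms(2)])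

lemma differential_mult:
  assumes "C1_on U f" "C1_on U g" "x \<in> U"
  shows "differential (\<lambda>y. f y * g y) x = f x *\<^sub>R differential g x + g x *\<^sub>R differential f x"
  by (rule differential_eqI) (rule has_derivative_mult_blinfun[OF assms])

lemma has_derivative_sum_blinfun:
  assumes "\<And>i. i \<in> I \<Longrightarrow> C1_on U (f i)" "x \<in> U"
  shows "((\<lambda>y. \<Sum>i\<in>I. f i y) has_derivative blinfun_apply (\<Sum>i\<in>I. differential (f i) x)) (at x)"
proof -
  have "blinfun_apply (\<Sum>i\<in>I. differential (f i) x) = (\<lambda>h. \<Sum>i\<in>I. differential (f i) x h)"
    by (auto simp: blinfun.sum_left)
  moreover have "((\<lambda>y. \<Sum>i\<in>I. f i y) has_derivative (\<lambda>h. \<Sum>i\<in>I. differential (f i) x h)) (at x)"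
    by (rule has_derivative_sum) (rule C1_on_has_differential[OF assms])
  ultimately show ?thesis by simp
qed

lemma C1_on_sum:
  assumes "\<And>i. i \<in> I \<Longrightarrow> C1_on U (f i)"
  shows "C1_on U (\<lambda>y. \<Sum>i\<in>I. f i y)"
  by (rule C1_onI[OF has_derivative_sum_blinfun[OF assms]], assumption+)
    (rule continuous_on_sum, rule C1_on_continuous_differential[OF assms])

lemma differential_sum:
  assumes "\<And>i. i \<in> I \<Longrightarrow> C1_on U (f i)" "x \<in> U"
  shows "differential (\<lambda>y. \<Sum>i\<in>I. f i y) x = (\<Sum>i\<in>I. differential (f i) x)"
  by (rule differential_eqI) (rule has_derivative_sum_blinfun[OF assms])

lemma has_derivative_compose_blinfun:
  assumes "C1_on U f" "x \<in> U" "(g has_real_derivative g') (at (f x))"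
  shows "((\<lambda>y. g (f y)) has_derivative blinfun_apply (g' *\<^sub>R differential f x)) (at x)"
  using DERIV_compose_FDERIV[OF assms(3) C1_on_has_differential[OF assms(1,2)]]
  by (simp add: blinfun.scaleR_left[abs_def] mult.commute)

lemma C1_on_compose:
  assumes "C1_on U f" "\<And>x. x \<in> U \<Longrightarrow> (g has_real_derivative g' (f x)) (at (f x))"
    "continuous_on U (\<lambda>x. g' (f x))"
  shows "C1_on U (\<lambda>y. g (f y))"
  by (rule C1_onI[OF has_derivative_compose_blinfun[OF assms(1) _ assms(2)]], assumption+)
    (intro continuous_intros C1_on_continuous_differential[OF assms(1)] assms(3))

lemma differential_compose:
  assumes "C1_on U f" "x \<in> U" "(g has_real_derivative g') (at (f x))"
  shows "differential (\<lambda>y. g (f y)) x = g' *\<^sub>R differential f x"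
  by (rule differential_eqI) (rule has_derivative_compose_blinfun[OF assms])

text \<open>
  The difference quotients in the direction \<open>h\<close> are bounded by \<open>K * norm h\<close>, hence so is their limit.
\<close>

lemma norm_derivative_le_lipschitz:
  fixes f :: "'a::real_normed_vector \<Rightarrow> real"
  assumes der: "(f has_derivative blinfun_apply D) (at x)" and "0 \<le> K"
    and lip: "\<And>y. \<bar>f y - f x\<bar> \<le> K * norm (y - x)"
  shows "norm D \<le> K"
proof (rule norm_blinfun_bound[OF \<open>0 \<le> K\<close>])
  fix h :: 'a
  show "norm (D h) \<le> K * norm h"
  proof (cases "h = 0")
    case False
    have "norm (D h) \<le> K * norm h + e * norm h" if "e > 0" for e
    proof -
      obtain d where "d > 0"
        and d: "\<And>y. norm (y - x) < d \<Longrightarrow> norm (f y - f x - D (y - x)) \<le> e * norm (y - x)"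
        using der \<open>e > 0\<close> unfolding has_derivative_at_alt by blast
      \<comment> \<open>small enough for the expansion at \<open>x\<close> to apply to the increment \<open>t h\<close>\<close>
      define t where "t = d / (2 * norm h)"
      have "t > 0" using \<open>d > 0\<close> False by (simp add: t_def)
      have "norm (t *\<^sub>R h) < d"
        using \<open>d > 0\<close> False by (simp add: t_def)
      then have "norm (f (x + t *\<^sub>R h) - f x - D (t *\<^sub>R h)) \<le> e * norm (t *\<^sub>R h)"
        using d[of "x + t *\<^sub>R h"] by simp
      moreover have "\<bar>f (x + t *\<^sub>R h) - f x\<bar> \<le> K * norm (t *\<^sub>R h)"
        using lip[of "x + t *\<^sub>R h"] by simp
      ultimately have "norm (D (t *\<^sub>R h)) \<le> K * norm (t *\<^sub>R h) + e * norm (t *\<^sub>R h)"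
        by (simp add: abs_le_iff)
      then have "t * norm (D h) \<le> t * (K * norm h + e * norm h)"
        using \<open>t > 0\<close> by (simp add: blinfun.scaleR_right abs_mult algebra_simps)
      then show ?thesis using \<open>t > 0\<close> by simp
    qed
    from this[of "e / norm h" for e] have "norm (D h) \<le> K * norm h + e" if "e > 0" for e
      using that False by simp
    then show ?thesis by (rule field_le_epsilon)
  qed simp
qed

lemma C1_on_norm_diff:
  fixes p :: "'a::real_normed_vector"
  assumes "C1_on (UNIV - {0}) (norm :: 'a \<Rightarrow> real)"
  shows "C1_on (- {p}) (\<lambda>y. norm (y - p))"
proof (rule C1_onI)
  show "((\<lambda>y. norm (y - p)) has_derivative blinfun_apply (differential norm (y - p))) (at y)"
    if "y \<in> - {p}" for y
  proof -
    have "(norm has_derivative blinfun_apply (differential norm (y - p))) (at (y - p))"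
      using C1_on_has_differential[OF assms] that by auto
    moreover have "((\<lambda>y. y - p) has_derivative (\<lambda>h. h)) (at y)"
      by (auto intro!: derivative_eq_intros)
    ultimately show ?thesis
      using has_derivative_compose[of "\<lambda>y. y - p" "\<lambda>h. h" y UNIV norm] by simp
  qed
  show "continuous_on (- {p}) (\<lambda>y. differential norm (y - p))"
    by (rule continuous_on_compose2[OF C1_on_continuous_differential[OF assms]])
      (auto intro!: continuous_intros)
qed

lemma norm_differential_norm_diff_le:
  fixes p :: "'a::real_normed_vector"
  assumes "C1_on (UNIV - {0}) (norm :: 'a \<Rightarrow> real)" "y \<noteq> p"
  shows "norm (differential (\<lambda>y. norm (y - p)) y) \<le> 1"
proof (rule norm_derivative_le_lipschitz)
  show "((\<lambda>y. norm (y - p)) has_derivative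
      blinfun_apply (differential (\<lambda>y. norm (y - p)) y)) (at y)"
    using C1_on_has_differential[OF C1_on_norm_diff[OF assms(1)]] assms(2) by blast
  show "\<bar>norm (z - p) - norm (y - p)\<bar> \<le> 1 * norm (z - y)" for z
    using norm_triangle_ineq3[of "z - p" "y - p"] by simp
qed simp

text \<open>
  All bumps and cut-offs are made from this function. It is \<open>C\<^sup>1\<close> because the derivatives \<open>0\<close> and \<open>2 t\<close> of its two
  branches agree at \<open>0\<close>.
\<close>

definition pos_square :: "real \<Rightarrow> real" where
  "pos_square t = (max 0 t)\<^sup>2"

lemma pos_square_nonneg: "0 \<le> pos_square t"
  by (simp add: pos_square_def)

lemma pos_square_eq_0: "t \<le> 0 \<Longrightarrow> pos_square t = 0"
  by (simp add: pos_square_def)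

lemma pos_square_mono: "s \<le> t \<Longrightarrow> pos_square s \<le> pos_square t"
  unfolding pos_square_def by (intro power_mono) auto

lemma pos_square_of_nonneg: "0 \<le> t \<Longrightarrow> pos_square t = t\<^sup>2"
  by (simp add: pos_square_def)

lemma has_derivative_pos_square: "(pos_square has_real_derivative 2 * max 0 t) (at t)"
proof (cases "t = 0")
  case True
  have "((\<lambda>y. (pos_square y - pos_square 0) / (y - 0)) \<longlongrightarrow> 0) (at 0)"
  proof (rule Lim_null_comparison)
    show "((\<lambda>y::real. \<bar>y\<bar>) \<longlongrightarrow> 0) (at 0)"
      by (auto intro!: tendsto_eq_intros)
    show "\<forall>\<^sub>F y in at (0::real). norm ((pos_square y - pos_square 0) / (y - 0)) \<le> \<bar>y\<bar>"
      by (auto simp: eventually_at_filter pos_square_def max_def power2_eq_square)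
  qed
  then show ?thesis
    using True by (simp add: has_field_derivative_iff)
next
  case False
  then consider "t > 0" | "t < 0" by linarith
  then show ?thesis
  proof cases
    case 1
    have "((\<lambda>t::real. t\<^sup>2) has_real_derivative 2 * max 0 t) (at t)"
      using 1 by (auto intro!: derivative_eq_intros)
    then show ?thesis
      by (rule has_field_derivative_transform_within_open[where S = "{0<..}"])
        (use 1 in \<open>auto simp: pos_square_def max_def\<close>)
  next
    case 2
    have "((\<lambda>t::real. 0) has_real_derivative 2 * max 0 t) (at t)"
      using 2 by (auto intro!: derivative_eq_intros)
    then show ?thesis
      by (rule has_field_derivative_transform_within_open[where S = "{..<0}"])
        (use 2 in \<open>auto simp: pos_square_def max_def\<close>)
  qed
qed

lemma C1_on_pos_square:
  assumes "C1_on U f"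
  shows "C1_on U (\<lambda>y. pos_square (f y))"
  by (rule C1_on_compose[OF assms has_derivative_pos_square])
    (intro continuous_intros C1_on_continuous[OF assms])

lemma differential_pos_square:
  assumes "C1_on U f" "x \<in> U"
  shows "differential (\<lambda>y. pos_square (f y)) x = (2 * max 0 (f x)) *\<^sub>R differential f x"
  by (rule differential_compose[OF assms has_derivative_pos_square])

section \<open>Separated nets in doubling sets\<close>

definition separated :: "real \<Rightarrow> 'a::metric_space set \<Rightarrow> bool" where
  "separated r A \<longleftrightarrow> (\<forall>x\<in>A. \<forall>y\<in>A. x \<noteq> y \<longrightarrow> r \<le> dist x y)"

text \<open>
  By Zorn's lemma there is a maximal separated subset; a point of \<open>X\<close> at distance at least \<open>r\<close> from
  all of it could be added.
\<close>

lemma maximal_separated_subset: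
  fixes X :: "'a::metric_space set"
  assumes "0 < r"
  shows "\<exists>A\<subseteq>X. separated r A \<and> (\<forall>x\<in>X. \<exists>a\<in>A. dist x a < r)"
proof -
  define \<A> where "\<A> = {A. A \<subseteq> X \<and> separated r A}"
  have "\<exists>A\<in>\<A>. \<forall>B\<in>\<A>. A \<subseteq> B \<longrightarrow> B = A"
  proof (rule subset_Zorn_nonempty)
    show "\<A> \<noteq> {}" by (auto simp: \<A>_def separated_def)
    fix \<C> assume "\<C> \<noteq> {}" and ch: "subset.chain \<A> \<C>"
    have "r \<le> dist x y" if xy: "x \<in> \<Union>\<C>" "y \<in> \<Union>\<C>" "x \<noteq> y" for x y
    proof -
      obtain B1 B2 where B: "B1 \<in> \<C>" "x \<in> B1" "B2 \<in> \<C>" "y \<in> B2"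
        using xy by blast
      then have "B1 \<subseteq> B2 \<or> B2 \<subseteq> B1" using ch by (simp add: subset_chain_def)
      then obtain B where "B \<in> \<C>" "x \<in> B" "y \<in> B" using B by blast
      moreover from this have "separated r B"
        using ch by (auto simp: subset_chain_def \<A>_def)
      ultimately show ?thesis
        using \<open>x \<noteq> y\<close> by (simp add: separated_def)
    qed
    moreover have "\<Union>\<C> \<subseteq> X" using ch by (auto simp: subset_chain_def \<A>_def)
    ultimately show "\<Union>\<C> \<in> \<A>"
      by (simp add: \<A>_def separated_def)
  qed
  then obtain A where A: "A \<subseteq> X" "separated r A"
    and max: "\<And>B. B \<subseteq> X \<Longrightarrow> separated r B \<Longrightarrow> A \<subseteq> B \<Longrightarrow> B = A"
    by (auto simp: \<A>_def)
  have "\<exists>a\<in>A. dist x a < r" if "x \<in> X" for x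
  proof (rule ccontr)
    assume "\<not> (\<exists>a\<in>A. dist x a < r)"
    then have far: "\<forall>a\<in>A. r \<le> dist x a" by force
    then have "separated r (insert x A)"
      using A(2) unfolding separated_def by (auto simp: dist_commute)
    then have "x \<in> A" using max[of "insert x A"] A(1) that by blast
    then have "r \<le> dist x x" using far by blast
    then show False using \<open>0 < r\<close> by simp
  qed
  then show ?thesis using A by blast
qed

lemma doubling_iterate:
  fixes X :: "'a::metric_space set"
  assumes "\<forall>r>0. \<forall>x\<in>X. \<exists>C\<subseteq>X. finite C \<and> card C \<le> N \<and> X \<inter> ball x (2 * r) \<subseteq> (\<Union>c\<in>C. X \<inter> ball c r)"
    and "0 < r" "x \<in> X"
  shows "\<exists>C\<subseteq>X. finite C \<and> card C \<le> N ^ k \<and> X \<inter> ball x (2 ^ k * r) \<subseteq> (\<Union>c\<in>C. X \<inter> ball c r)"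
  using assms(2,3)
proof (induction k arbitrary: x)
  case 0
  then show ?case by (intro exI[of _ "{x}"]) auto
next
  case (Suc k)
  have pos: "0 < 2 ^ k * r" using Suc.prems(1) by simp
  obtain C where C: "C \<subseteq> X" "finite C" "card C \<le> N"
    "X \<inter> ball x (2 * (2 ^ k * r)) \<subseteq> (\<Union>c\<in>C. X \<inter> ball c (2 ^ k * r))"
    using assms(1)[THEN spec, THEN mp, OF pos, THEN bspec, OF Suc.prems(2)] by (elim exE conjE)
  have "\<forall>c\<in>C. \<exists>B\<subseteq>X. finite B \<and> card B \<le> N ^ k \<and>
      X \<inter> ball c (2 ^ k * r) \<subseteq> (\<Union>b\<in>B. X \<inter> ball b r)"
    by (rule ballI) (rule Suc.IH[OF Suc.prems(1) subsetD[OF C(1)]])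
  then obtain B where B: "\<forall>c\<in>C. B c \<subseteq> X \<and> finite (B c) \<and> card (B c) \<le> N ^ k \<and>
      X \<inter> ball c (2 ^ k * r) \<subseteq> (\<Union>b\<in>B c. X \<inter> ball b r)"
    by (rule bchoice[elim_format]) (elim exE)
  have "card (\<Union>c\<in>C. B c) \<le> (\<Sum>c\<in>C. card (B c))"
    by (rule card_UN_le[OF C(2)])
  also have "\<dots> \<le> card C * N ^ k"
    using sum_bounded_above[of C "\<lambda>c. card (B c)" "N ^ k"] B by simp
  also have "\<dots> \<le> N ^ Suc k"
    using C(3) by simp
  finally have "card (\<Union>c\<in>C. B c) \<le> N ^ Suc k" .
  moreover have "X \<inter> ball x (2 ^ Suc k * r) \<subseteq> (\<Union>b\<in>(\<Union>c\<in>C. B c). X \<inter> ball b r)"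
  proof
    fix z assume z: "z \<in> X \<inter> ball x (2 ^ Suc k * r)"
    then have "z \<in> X \<inter> ball x (2 * (2 ^ k * r))" by (simp add: mult.assoc)
    then obtain c where "c \<in> C" and zc: "z \<in> X \<inter> ball c (2 ^ k * r)" using C(4) by auto
    from B \<open>c \<in> C\<close> have "X \<inter> ball c (2 ^ k * r) \<subseteq> (\<Union>b\<in>B c. X \<inter> ball b r)" by simp
    then have "z \<in> (\<Union>b\<in>B c. X \<inter> ball b r)" using zc by (rule subsetD)
    with \<open>c \<in> C\<close> show "z \<in> (\<Union>b\<in>(\<Union>c\<in>C. B c). X \<inter> ball b r)" by auto
  qed
  moreover have "(\<Union>c\<in>C. B c) \<subseteq> X" "finite (\<Union>c\<in>C. B c)"
    using C(2) B by auto
  ultimately show ?case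
    by (intro exI[of _ "\<Union>c\<in>C. B c"] conjI)
qed

text \<open>
  A ball of radius \<open>r / 2\<close> contains at most one point of an \<open>r\<close>-separated set, so it suffices to count
  the balls of radius \<open>r / 2\<close> in an iterated doubling cover. The centre \<open>y\<close> may lie outside \<open>X\<close>,
  which is why the ball is first recentred at one of the points to be counted, at the price of
  doubling its radius.
\<close>

lemma doubling_separated_card:
  fixes X :: "'a::metric_space set"
  assumes "doubling X"
  obtains M :: nat where
    "\<And>r s A y. \<lbrakk>A \<subseteq> X; 0 < r; separated r A; s \<le> 2 ^ k * r\<rbrakk> \<Longrightarrow>
      finite {x\<in>A. dist x y < s} \<and> card {x\<in>A. dist x y < s} \<le> M"
proof -
  obtain N :: nat where N: "\<forall>r>0. \<forall>x\<in>X. \<exists>C\<subseteq>X. finite C \<and> card C \<le> N \<and>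
     X \<inter> ball x (2 * r) \<subseteq> (\<Union>c\<in>C. X \<inter> ball c r)"
    using assms unfolding doubling_def by blast
  have "finite {x\<in>A. dist x y < s} \<and> card {x\<in>A. dist x y < s} \<le> N ^ (k + 2)"
    if A: "A \<subseteq> X" "0 < r" "separated r A" "s \<le> 2 ^ k * r" for r s A y
  proof (cases "{x\<in>A. dist x y < s} = {}")
    case False
    let ?B = "{x\<in>A. dist x y < s}"
    obtain x where x: "x \<in> A" "dist x y < s" using False by blast
    have "0 < r / 2" "x \<in> X" using x A by auto
    from doubling_iterate[OF N this, of "k + 2"] obtain C where C: "finite C" "card C \<le> N ^ (k + 2)"
      "X \<inter> ball x (2 ^ (k + 2) * (r / 2)) \<subseteq> (\<Union>c\<in>C. X \<inter> ball c (r / 2))"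
      by blast
    have "?B \<subseteq> X \<inter> ball x (2 ^ (k + 2) * (r / 2))"
    proof
      fix z assume z: "z \<in> ?B"
      then have "dist x z < 2 * s"
        using x dist_triangle2[of x z y] by simp
      also have "\<dots> \<le> 2 ^ (k + 2) * (r / 2)" using A(4) by (simp add: mult.commute)
      finally show "z \<in> X \<inter> ball x (2 ^ (k + 2) * (r / 2))" using z A(1) by auto
    qed
    then have "\<forall>z\<in>?B. \<exists>c\<in>C. dist c z < r / 2" using C(3) by fastforce
    then obtain c where c: "\<And>z. z \<in> ?B \<Longrightarrow> c z \<in> C \<and> dist (c z) z < r / 2" by metis
    have "inj_on c ?B"
    proof (rule inj_onI, rule ccontr)
      fix z w assume zw: "z \<in> ?B" "w \<in> ?B" "c z = c w" "z \<noteq> w"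
      have "dist z w < r"
        using c[OF zw(1)] c[OF zw(2)] zw(3) dist_triangle3[of z w "c z"] by simp
      then show False using A(3) zw unfolding separated_def by force
    qed
    moreover have "c ` ?B \<subseteq> C" using c by blast
    ultimately have "finite ?B" "card ?B \<le> card C"
      using C(1) inj_on_finite card_inj_on_le by blast+
    then show ?thesis
      using C(2) by linarith
  next
    case True
    show ?thesis unfolding True by simp
  qed
  then show ?thesis using that by blast
qed

section \<open>Whitney partitions of unity\<close>

text \<open>
  The family \<open>v\<close> is a \<open>C\<^sup>1\<close> partition of unity off \<open>X\<close>, and \<open>v j\<close> carries a point \<open>p j\<close> of \<open>X\<close>. The
  partition is adapted to the distance from \<open>X\<close> with constant \<open>C\<close>. The bound on the differentials is
  imposed on their sum, so that no separate bound on the number of active indices is necessary.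
\<close>

definition whitney_partition ::
  "'a::real_normed_vector set \<Rightarrow> 'j set \<Rightarrow> ('j \<Rightarrow> 'a) \<Rightarrow> ('j \<Rightarrow> 'a \<Rightarrow> real) \<Rightarrow> real \<Rightarrow> bool" where
  "whitney_partition X J p v C \<longleftrightarrow> 0 \<le> C \<and>
     (\<forall>j\<in>J. p j \<in> X \<and> C1_on (- X) (v j) \<and> (\<forall>y. 0 \<le> v j y)) \<and>
     (\<forall>y\<in>- X. \<exists>K V. finite K \<and> K \<subseteq> J \<and> open V \<and> y \<in> V \<and> V \<subseteq> - X \<and>
        (\<forall>z\<in>V. (\<forall>j\<in>J - K. v j z = 0) \<and> (\<Sum>j\<in>K. v j z) = 1) \<and>
        (\<forall>j\<in>K. dist (p j) y \<le> C * infdist y X) \<and>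
        (\<Sum>j\<in>K. norm (differential (v j) y)) * infdist y X \<le> C)"

lemma powi_2_less_imp_less: "(2::real) powi m < 2 powi n \<Longrightarrow> m < n"
  using power_int_increasing[of n m "2::real"] by (meson linorder_not_less one_le_numeral)

lemma dyadic_scale:
  fixes d :: real
  assumes "0 < d"
  obtains n where "2 powi n \<le> d" "d < 2 * 2 powi n"
proof -
  let ?n = "\<lfloor>log 2 d\<rfloor>"
  have d: "d = 2 powr (log 2 d)" using assms by simp
  have "2 powi ?n \<le> d"
    by (subst (2) d) (simp flip: powr_real_of_int')
  moreover have "d < 2 powi (?n + 1)"
    by (subst d) (simp flip: powr_real_of_int')
  ultimately show ?thesis
    using that[of ?n] by (simp add: power_int_add)
qed

text \<open>
  The set \<open>A n\<close> is the net of scale \<open>2\<^sup>n\<close>. The factor \<open>2\<^sup>8\<close> is large enough for all the counts below;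
  the largest radius that occurs is \<open>17 * 2\<^sup>N\<close> for a net of scale \<open>n \<ge> N - 2\<close>, that is, \<open>68 * 2\<^sup>n\<close>.
\<close>

locale whitney_nets =
  fixes X :: "'a::real_normed_vector set" and A :: "int \<Rightarrow> 'a set" and M :: nat
  assumes C1_norm: "C1_on (UNIV - {0}) (norm :: 'a \<Rightarrow> real)"
    and closed_X: "closed X" and X_nonempty: "X \<noteq> {}"
    and net_subset: "A n \<subseteq> X"
    and net_near: "x \<in> X \<Longrightarrow> \<exists>a\<in>A n. dist x a < 2 powi n"
    and net_finite: "s \<le> 2 ^ 8 * 2 powi n \<Longrightarrow> finite {x\<in>A n. dist x y < s}"
    and net_card: "s \<le> 2 ^ 8 * 2 powi n \<Longrightarrow> card {x\<in>A n. dist x y < s} \<le> M"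
begin

text \<open>
  A bump of radius \<open>4 * 2\<^sup>n\<close> around \<open>x\<close> that is at least \<open>1\<close> at distance up to \<open>3 * 2\<^sup>n\<close>. It need not be
  differentiable at \<open>x\<close> itself, but \<open>x\<close> belongs to \<open>X\<close> and only the complement of \<open>X\<close> matters.
\<close>

definition bump :: "int \<Rightarrow> 'a \<Rightarrow> 'a \<Rightarrow> real" where
  "bump n x y = pos_square (4 - norm (y - x) / 2 powi n)"

text \<open>
  The sum of all bumps of one scale. It plays the part of a cut-off function of the distance from
  \<open>X\<close>.
\<close>

definition density :: "int \<Rightarrow> 'a \<Rightarrow> real" where
  "density n y = (\<Sum>x | x \<in> A n \<and> dist x y < 4 * 2 powi n. bump n x y)"

text \<open>
  The second factor vanishes when \<open>y\<close> is so close to \<open>X\<close> that the bumps two scales below already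
  add up to \<open>1\<close>, and it is \<open>1\<close> when none of them is active.
\<close>

definition weight :: "int \<times> 'a \<Rightarrow> 'a \<Rightarrow> real" where
  "weight j y = bump (fst j) (snd j) y * pos_square (1 - density (fst j - 2) y)"

definition indices :: "(int \<times> 'a) set" where
  "indices = (SIGMA n : UNIV. A n)"

definition total_weight :: "'a \<Rightarrow> real" where
  "total_weight y = (\<Sum>j | j \<in> indices \<and> weight j y \<noteq> 0. weight j y)"

lemma net_mem: "x \<in> A n \<Longrightarrow> x \<in> X"
  using net_subset by blast

lemma bump_nonneg: "0 \<le> bump n x y"
  by (simp add: bump_def pos_square_nonneg)

lemma bump_eq_0:
  assumes "4 * 2 powi n \<le> dist x y"
  shows "bump n x y = 0"
proof -
  have "0 < (2::real) powi n" by simp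
  then have "4 \<le> norm (y - x) / 2 powi n"
    using assms by (simp add: dist_norm norm_minus_commute pos_le_divide_eq)
  then show ?thesis by (simp add: bump_def pos_square_eq_0)
qed

lemma bump_ge_1:
  assumes "dist x y \<le> 3 * 2 powi n"
  shows "1 \<le> bump n x y"
proof -
  have "0 < (2::real) powi n" by simp
  then have "norm (y - x) / 2 powi n \<le> 3"
    using assms by (simp add: dist_norm norm_minus_commute pos_divide_le_eq)
  then have "pos_square 1 \<le> bump n x y"
    unfolding bump_def by (intro pos_square_mono) simp
  then show ?thesis by (simp add: pos_square_of_nonneg)
qed

lemma bump_le: "bump n x y \<le> 16"
proof -
  have "bump n x y \<le> pos_square 4"
    unfolding bump_def by (intro pos_square_mono) simp
  then show ?thesis by (simp add: pos_square_of_nonneg)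
qed

lemma C1_on_scaled_distance: "C1_on (- {x}) (\<lambda>y. 4 - norm (y - x) / 2 powi n)" for x :: 'a
  by (rule C1_on_compose[OF C1_on_norm_diff[OF C1_norm],
        where g = "\<lambda>t. 4 - t / 2 powi n" and g' = "\<lambda>_. - (1 / 2 powi n)"])
    (auto intro!: derivative_eq_intros)

lemma C1_on_bump: "x \<in> X \<Longrightarrow> C1_on (- X) (bump n x)"
  unfolding bump_def
  by (rule C1_on_subset[OF C1_on_pos_square[OF C1_on_scaled_distance]]) auto

lemma norm_differential_bump:
  assumes "y \<noteq> x"
  shows "norm (differential (bump n x) y) \<le> 8 / 2 powi n"
proof -
  have y: "y \<in> - {x}" using assms by simp
  have "differential (\<lambda>y. 4 - norm (y - x) / 2 powi n) y =
      (- 1 / 2 powi n) *\<^sub>R differential (\<lambda>y. norm (y - x)) y"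
    by (rule differential_compose[OF C1_on_norm_diff[OF C1_norm] y,
          where g = "\<lambda>t. 4 - t / 2 powi n"])
      (auto intro!: derivative_eq_intros)
  then have "norm (differential (\<lambda>y. 4 - norm (y - x) / 2 powi n) y) \<le> 1 / 2 powi n"
    using norm_differential_norm_diff_le[OF C1_norm assms] by (simp add: divide_right_mono)
  moreover have "2 * max 0 (4 - norm (y - x) / 2 powi n) \<le> 8" by simp
  ultimately have "2 * max 0 (4 - norm (y - x) / 2 powi n) *
      norm (differential (\<lambda>y. 4 - norm (y - x) / 2 powi n) y) \<le> 8 * (1 / 2 powi n)"
    by (intro mult_mono) auto
  then show ?thesis
    unfolding bump_def differential_pos_square[OF C1_on_scaled_distance y] by simp
qed

lemma density_eq_sum:
  assumes "finite B" "B \<subseteq> A n" "\<And>x. x \<in> A n \<Longrightarrow> dist x y < 4 * 2 powi n \<Longrightarrow> x \<in> B"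
  shows "density n y = (\<Sum>x\<in>B. bump n x y)"
  unfolding density_def
proof (rule sum.mono_neutral_left[OF assms(1)])
  show "{x. x \<in> A n \<and> dist x y < 4 * 2 powi n} \<subseteq> B" using assms(3) by blast
  show "\<forall>x\<in>B - {x. x \<in> A n \<and> dist x y < 4 * 2 powi n}. bump n x y = 0"
    using assms(2) by (auto intro!: bump_eq_0)
qed

lemma density_nonneg: "0 \<le> density n y"
  unfolding density_def by (intro sum_nonneg bump_nonneg)

text \<open>
  There is a point of \<open>X\<close> within \<open>2 * 2\<^sup>n\<close> of \<open>y\<close> and a net point within \<open>2\<^sup>n\<close> of that point; the bump of this
  net point is at least \<open>1\<close> at \<open>y\<close>.
\<close>

lemma density_ge_1:
  assumes "infdist y X < 2 * 2 powi n"
  shows "1 \<le> density n y"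
proof -
  have "\<exists>x\<in>X. dist y x < 2 * 2 powi n"
    using cInf_lessD[of "dist y ` X"] assms X_nonempty by (auto simp: infdist_notempty)
  then obtain x where x: "x \<in> X" "dist y x < 2 * 2 powi n" by blast
  obtain a where a: "a \<in> A n" "dist x a < 2 powi n" using net_near[OF x(1)] by blast
  have near: "dist a y < 3 * 2 powi n"
    using dist_triangle[of a y x] x(2) a(2) by (simp add: dist_commute)
  have pos: "0 < (2::real) powi n" by simp
  have "dist a y < 4 * 2 powi n" using near pos by linarith
  have "1 \<le> bump n a y" using near by (intro bump_ge_1) simp
  also have "bump n a y = (\<Sum>x\<in>{a}. bump n x y)" by simp
  also have "\<dots> \<le> density n y"
    unfolding density_def
  proof (rule sum_mono2)
    show "finite {x. x \<in> A n \<and> dist x y < 4 * 2 powi n}" using net_finite by simp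
    show "{a} \<subseteq> {x. x \<in> A n \<and> dist x y < 4 * 2 powi n}" using a(1) \<open>dist a y < 4 * 2 powi n\<close> by blast
  qed (rule bump_nonneg)
  finally show ?thesis .
qed

lemma density_eq_0:
  assumes "4 * 2 powi n \<le> infdist y X"
  shows "density n y = 0"
proof -
  have "infdist y X \<le> dist x y" if "x \<in> A n" for x
    using infdist_le[of x X y] net_subset that by (auto simp: dist_commute)
  then have "\<not> (x \<in> A n \<and> dist x y < 4 * 2 powi n)" for x
    using assms by force
  then have "{x. x \<in> A n \<and> dist x y < 4 * 2 powi n} = {}" by blast
  then show ?thesis unfolding density_def by (simp only: sum.empty)
qed

lemma density_local:
  assumes "z \<in> ball y (2 powi n)"
  shows "(\<Sum>x | x \<in> A n \<and> dist x y < 5 * 2 powi n. bump n x z) = density n z"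
proof (rule density_eq_sum[symmetric])
  show "finite {x. x \<in> A n \<and> dist x y < 5 * 2 powi n}" using net_finite by simp
  show "x \<in> {x. x \<in> A n \<and> dist x y < 5 * 2 powi n}"
    if "x \<in> A n" "dist x z < 4 * 2 powi n" for x
    using dist_triangle2[of x y z] assms that by simp
qed blast

lemma C1_on_density_local:
  "C1_on (- X) (\<lambda>z. \<Sum>x | x \<in> A n \<and> dist x y < 5 * 2 powi n. bump n x z)"
  by (rule C1_on_sum, rule C1_on_bump) (use net_subset in blast)

lemma C1_on_density: "C1_on (- X) (density n)"
proof (rule C1_on_local)
  fix y assume "y \<in> - X"
  let ?V = "- X \<inter> ball y (2 powi n)"
  have "open ?V" using closed_X by auto
  moreover have "C1_on ?V (density n)"
    by (rule C1_on_cong_open[OF C1_on_subset[OF C1_on_density_local[of n y]] \<open>open ?V\<close>])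
      (auto intro!: density_local)
  ultimately show "\<exists>V. open V \<and> y \<in> V \<and> C1_on V (density n)"
    using \<open>y \<in> - X\<close> by (intro exI[of _ ?V]) simp
qed

lemma norm_differential_density:
  assumes "y \<in> - X"
  shows "norm (differential (density n) y) \<le> 8 * M / 2 powi n"
proof -
  let ?V = "- X \<inter> ball y (2 powi n)" and ?B = "{x. x \<in> A n \<and> dist x y < 5 * 2 powi n}"
  have V: "open ?V" "y \<in> ?V" using closed_X assms by auto
  have B: "finite ?B" "card ?B \<le> M" using net_finite net_card by simp_all
  have "differential (density n) y = differential (\<lambda>z. \<Sum>x\<in>?B. bump n x z) y"
    by (rule differential_cong_open[OF C1_on_subset[OF C1_on_density_local[of n y]] V(1) _ V(2)])
      (auto intro!: density_local)
  also have "\<dots> = (\<Sum>x\<in>?B. differential (bump n x) y)"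
    by (rule differential_sum[OF C1_on_bump assms]) (use net_subset in blast)
  finally have "norm (differential (density n) y) \<le> (\<Sum>x\<in>?B. norm (differential (bump n x) y))"
    using norm_sum by simp
  also have "\<dots> \<le> of_nat (card ?B) * (8 / 2 powi n)"
    using assms net_subset by (intro sum_bounded_above norm_differential_bump) blast
  also have "\<dots> \<le> M * (8 / 2 powi n)"
    using B by (intro mult_right_mono) auto
  finally show ?thesis by (simp add: mult.commute)
qed

lemma weight_nonneg: "0 \<le> weight j y"
  by (simp add: weight_def bump_nonneg pos_square_nonneg)

lemma pos_square_density_le_1: "pos_square (1 - density n y) \<le> 1"
  using pos_square_mono[of "1 - density n y" 1] density_nonneg[of n y]
  by (simp add: pos_square_of_nonneg)

lemma powi_minus_2: "(2::real) powi (n - 2) = 2 powi n / 4"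
  by (simp add: power_int_diff)

text \<open>
  The cut-off gives a lower bound for the distance from \<open>X\<close>, the bump an upper bound, so only scales
  comparable with the distance are active.
\<close>

lemma weight_support:
  assumes "weight (n, x) y \<noteq> 0"
  shows "2 powi n \<le> 2 * infdist y X" "dist x y < 4 * 2 powi n"
proof -
  show "dist x y < 4 * 2 powi n"
    using assms bump_eq_0[of n x y] by (auto simp: weight_def not_le[symmetric])
  have "\<not> infdist y X < 2 * 2 powi (n - 2)"
    using assms density_ge_1[of y "n - 2"] by (auto simp: weight_def pos_square_eq_0)
  then show "2 powi n \<le> 2 * infdist y X" by (simp add: powi_minus_2)
qed

lemma C1_on_one_minus_density: "C1_on (- X) (\<lambda>y. 1 - density n y)"
  by (rule C1_on_compose[OF C1_on_density, where g = "\<lambda>t. 1 - t" and g' = "\<lambda>_. - 1"])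
    (auto intro!: derivative_eq_intros)

lemma C1_on_weight: "j \<in> indices \<Longrightarrow> C1_on (- X) (weight j)"
  unfolding weight_def indices_def
  by (intro C1_on_mult C1_on_bump C1_on_pos_square C1_on_one_minus_density) (auto intro: net_mem)

text \<open>
  The product rule: the bump is at most \<open>16\<close> with differential at most \<open>8 / 2\<^sup>n\<close>, the cut-off is at
  most \<open>1\<close> with differential at most \<open>2 * (8 M / 2\<^bsup>n-2\<^esup>) = 64 M / 2\<^sup>n\<close>.
\<close>

lemma norm_differential_weight:
  assumes "j \<in> indices" "y \<in> - X"
  shows "norm (differential (weight j) y) \<le> (8 + 1024 * M) / 2 powi (fst j)"
proof -
  obtain n x where j: "j = (n, x)" by (cases j)
  let ?\<theta> = "\<lambda>y. pos_square (1 - density (n - 2) y)"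
  have x: "x \<in> X" "y \<noteq> x" using assms net_mem by (auto simp: indices_def j)
  have "differential (\<lambda>y. 1 - density (n - 2) y) y = (- 1) *\<^sub>R differential (density (n - 2)) y"
    by (rule differential_compose[OF C1_on_density assms(2), where g = "\<lambda>t. 1 - t"])
      (auto intro!: derivative_eq_intros)
  then have "norm (differential (\<lambda>y. 1 - density (n - 2) y) y) \<le> 8 * M / 2 powi (n - 2)"
    using norm_differential_density[OF assms(2), of "n - 2"] by simp
  moreover have "2 * max 0 (1 - density (n - 2) y) \<le> 2"
    using density_nonneg[of "n - 2" y] by simp
  ultimately have "2 * max 0 (1 - density (n - 2) y) *
      norm (differential (\<lambda>y. 1 - density (n - 2) y) y) \<le> 2 * (8 * M / 2 powi (n - 2))"
    by (intro mult_mono) auto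
  then have \<theta>: "norm (differential ?\<theta> y) \<le> 64 * M / 2 powi n"
    unfolding differential_pos_square[OF C1_on_one_minus_density assms(2)]
    by (simp add: powi_minus_2)
  have "differential (weight j) y =
      bump n x y *\<^sub>R differential ?\<theta> y + ?\<theta> y *\<^sub>R differential (bump n x) y"
    unfolding weight_def j fst_conv snd_conv
    by (rule differential_mult[OF C1_on_bump[OF x(1)]
          C1_on_pos_square[OF C1_on_one_minus_density] assms(2)])
  then have "norm (differential (weight j) y) \<le>
      bump n x y * norm (differential ?\<theta> y) + ?\<theta> y * norm (differential (bump n x) y)"
    using norm_triangle_ineq[of "bump n x y *\<^sub>R differential ?\<theta> y"
        "?\<theta> y *\<^sub>R differential (bump n x) y"]
    by (simp add: bump_nonneg pos_square_nonneg)
  also have "\<dots> \<le> 16 * (64 * M / 2 powi n) + 1 * (8 / 2 powi n)"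
    using bump_le norm_differential_bump[OF x(2)] \<theta> pos_square_density_le_1
    by (intro add_mono mult_mono) auto
  finally show ?thesis by (simp add: j add_divide_distrib)
qed

text \<open>
  A finite set that contains every index active near a point \<open>y\<close> whose distance from \<open>X\<close> lies between
  \<open>2\<^sup>N\<close> and \<open>2\<^bsup>N+1\<^esup>\<close>.
\<close>

definition local_indices :: "int \<Rightarrow> 'a \<Rightarrow> (int \<times> 'a) set" where
  "local_indices N y = (SIGMA n : {N - 2..N + 2}. {x\<in>A n. dist x y < 17 * 2 powi N})"

lemma local_indices_subset: "local_indices N y \<subseteq> indices"
  by (auto simp: local_indices_def indices_def)

lemma powi_ge_quarter: "N - 2 \<le> n \<Longrightarrow> (2::real) powi N / 4 \<le> 2 powi n"
  using power_int_increasing[of "N - 2" n "2::real"] by (simp add: powi_minus_2)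

lemma local_indices_card:
  "finite (local_indices N y)" "card (local_indices N y) \<le> 5 * M"
proof -
  have *: "finite {x\<in>A n. dist x y < 17 * 2 powi N} \<and>
      card {x\<in>A n. dist x y < 17 * 2 powi N} \<le> M" if "n \<in> {N - 2..N + 2}" for n
  proof -
    have "17 * 2 powi N \<le> 2 ^ 8 * (2::real) powi n"
    proof -
      have "(2::real) powi N / 4 \<le> 2 powi n" "0 < (2::real) powi n"
        using that by (auto intro!: powi_ge_quarter simp del: divide_le_eq_numeral1)
      then have "17 * 2 powi N \<le> 256 * (2::real) powi n" by linarith
      then show ?thesis by simp
    qed
    then show ?thesis using net_finite net_card by blast
  qed
  then show "finite (local_indices N y)"
    unfolding local_indices_def by (intro finite_SigmaI) auto
  have "card (local_indices N y) = (\<Sum>n\<in>{N - 2..N + 2}. card {x\<in>A n. dist x y < 17 * 2 powi N})"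
    unfolding local_indices_def using * by (intro card_SigmaI) auto
  also have "\<dots> \<le> of_nat (card {N - 2..N + 2}) * M"
    using * by (intro sum_bounded_above) blast
  finally show "card (local_indices N y) \<le> 5 * M" by simp
qed

text \<open>
  The distance \<open>d\<close> of \<open>z\<close> from \<open>X\<close> is between \<open>2\<^sup>N / 2\<close> and \<open>5/2 * 2\<^sup>N\<close>. An active scale \<open>n\<close> satisfies
  \<open>d / 4 < 2\<^sup>n \<le> 2 d\<close>, hence \<open>\<bar>n - N\<bar> \<le> 2\<close>, and its point is within \<open>4 * 2\<^sup>n + 2\<^sup>N / 2 \<le> 33/2 * 2\<^sup>N\<close> of
  \<open>y\<close>.
\<close>

lemma weight_local:
  assumes "2 powi N \<le> infdist y X" "infdist y X < 2 * 2 powi N"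
    and z: "dist y z < 2 powi N / 2"
    and j: "j \<in> indices" "weight j z \<noteq> 0"
  shows "j \<in> local_indices N y"
proof -
  obtain n x where jnx: "j = (n, x)" by (cases j)
  have w: "2 powi n \<le> 2 * infdist z X" "dist x z < 4 * 2 powi n"
    using weight_support[of n x z] j(2) jnx by auto
  have x: "x \<in> A n" "x \<in> X" using j(1) jnx net_mem by (auto simp: indices_def)
  have dz: "infdist z X < 5 / 2 * 2 powi N" "2 powi N / 2 < infdist z X"
    using infdist_triangle_abs[of y X z] assms by (simp_all add: abs_le_iff)
  have "infdist z X \<le> dist x z" using infdist_le[OF x(2), of z] by (simp add: dist_commute)
  then have "2 powi (N - 3) < (2::real) powi n"
    using w(2) dz(2) by (simp add: power_int_diff)
  then have "N - 3 < n" by (rule powi_2_less_imp_less)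
  have "(2::real) powi n < 2 powi (N + 3)"
  proof -
    have "2 powi (N + 3) = 8 * (2::real) powi N" "0 < (2::real) powi N"
      by (simp_all add: power_int_add)
    then show ?thesis using w(1) dz(1) by linarith
  qed
  then have "n < N + 3" by (rule powi_2_less_imp_less)
  then have "(2::real) powi n \<le> 2 powi (N + 2)" by (intro power_int_increasing) auto
  then have "(2::real) powi n \<le> 4 * 2 powi N" by (simp add: power_int_add)
  then have "dist x y < 17 * 2 powi N"
    using w(2) z dist_triangle2[of x y z] zero_less_power_int[of "2::real" N] by linarith
  then show ?thesis
    using \<open>N - 3 < n\<close> \<open>n < N + 3\<close> x(1) by (simp add: local_indices_def jnx)
qed

lemma total_weight_local:
  assumes "2 powi N \<le> infdist y X" "infdist y X < 2 * 2 powi N" "dist y z < 2 powi N / 2"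
  shows "(\<Sum>j\<in>local_indices N y. weight j z) = total_weight z"
  unfolding total_weight_def
proof (rule sum.mono_neutral_right[OF local_indices_card(1)])
  show "{j. j \<in> indices \<and> weight j z \<noteq> 0} \<subseteq> local_indices N y"
    using weight_local[OF assms] by blast
  show "\<forall>j\<in>local_indices N y - {j. j \<in> indices \<and> weight j z \<noteq> 0}. weight j z = 0"
    using local_indices_subset by blast
qed

lemma infdist_pos: "y \<in> - X \<Longrightarrow> 0 < infdist y X"
  using infdist_pos_not_in_closed[OF closed_X X_nonempty] by simp

text \<open>
  For \<open>2\<^sup>N \<le> d < 2 * 2\<^sup>N\<close> the cut-off at scale \<open>N\<close> is \<open>1\<close>, because no bump of scale \<open>N - 2\<close> reaches \<open>y\<close>;
  so the weights of scale \<open>N\<close> alone add up to the density of that scale, which is at least \<open>1\<close>.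
\<close>

lemma total_weight_ge_1:
  assumes "y \<in> - X"
  shows "1 \<le> total_weight y"
proof -
  obtain N where N: "2 powi N \<le> infdist y X" "infdist y X < 2 * 2 powi N"
    using dyadic_scale[OF infdist_pos[OF assms]] .
  let ?B = "{x. x \<in> A N \<and> dist x y < 4 * 2 powi N}"
  have pos: "0 < (2::real) powi N" by simp
  have "density (N - 2) y = 0"
    using N(1) by (intro density_eq_0) (simp add: powi_minus_2)
  then have w: "weight (N, x) y = bump N x y" for x
    by (simp add: weight_def pos_square_of_nonneg)
  have "1 \<le> density N y" by (rule density_ge_1[OF N(2)])
  also have "\<dots> = (\<Sum>j\<in>Pair N ` ?B. weight j y)"
    unfolding density_def by (subst sum.reindex) (auto simp: inj_on_def w)
  also have "\<dots> \<le> (\<Sum>j\<in>local_indices N y. weight j y)"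
  proof (rule sum_mono2[OF local_indices_card(1) _ weight_nonneg])
    have "dist x y < 17 * 2 powi N" if "dist x y < 4 * 2 powi N" for x
      using that pos by linarith
    then show "Pair N ` ?B \<subseteq> local_indices N y"
      unfolding local_indices_def by auto
  qed
  also have "\<dots> = total_weight y"
    using pos by (intro total_weight_local N) simp
  finally show ?thesis .
qed

lemma C1_on_total_weight_local: "C1_on (- X) (\<lambda>z. \<Sum>j\<in>local_indices N y. weight j z)"
  by (rule C1_on_sum, rule C1_on_weight) (use local_indices_subset in blast)

lemma C1_on_total_weight: "C1_on (- X) total_weight"
proof (rule C1_on_local)
  fix y assume y: "y \<in> - X"
  obtain N where N: "2 powi N \<le> infdist y X" "infdist y X < 2 * 2 powi N"
    using dyadic_scale[OF infdist_pos[OF y]] .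
  let ?V = "- X \<inter> ball y (2 powi N / 2)"
  have "open ?V" using closed_X by auto
  moreover have "C1_on ?V total_weight"
    by (rule C1_on_cong_open[OF C1_on_subset[OF C1_on_total_weight_local[of N y]] \<open>open ?V\<close>])
      (auto intro!: total_weight_local N)
  ultimately show "\<exists>V. open V \<and> y \<in> V \<and> C1_on V total_weight"
    using y by (intro exI[of _ ?V]) simp
qed

lemma norm_differential_total_weight:
  assumes y: "y \<in> - X" and N: "2 powi N \<le> infdist y X" "infdist y X < 2 * 2 powi N"
  shows "norm (differential total_weight y) \<le>
    (\<Sum>j\<in>local_indices N y. norm (differential (weight j) y))"
proof -
  let ?V = "- X \<inter> ball y (2 powi N / 2)"
  have V: "open ?V" "y \<in> ?V" using closed_X y by auto
  have "differential total_weight y = differential (\<lambda>z. \<Sum>j\<in>local_indices N y. weight j z) y"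
    by (rule differential_cong_open[OF C1_on_subset[OF C1_on_total_weight_local[of N y]]
          V(1) _ V(2)])
      (auto intro!: total_weight_local N)
  also have "\<dots> = (\<Sum>j\<in>local_indices N y. differential (weight j) y)"
    by (rule differential_sum[OF C1_on_weight y]) (use local_indices_subset in blast)
  finally show ?thesis
    using norm_sum by simp
qed

lemma sum_norm_differential_weight:
  assumes y: "y \<in> - X"
  shows "(\<Sum>j\<in>local_indices N y. norm (differential (weight j) y)) \<le>
    5 * M * (4 * (8 + 1024 * M) / 2 powi N)"
proof -
  have "norm (differential (weight j) y) \<le> 4 * (8 + 1024 * M) / 2 powi N"
    if "j \<in> local_indices N y" for j
  proof -
    have "(2::real) powi N / 4 \<le> 2 powi (fst j)"
      using that by (intro powi_ge_quarter) (auto simp: local_indices_def)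
    then have "real (8 + 1024 * M) / 2 powi (fst j) \<le> (8 + 1024 * M) / (2 powi N / 4)"
      by (intro divide_left_mono) auto
    moreover have "norm (differential (weight j) y) \<le> (8 + 1024 * M) / 2 powi (fst j)"
      using that local_indices_subset y by (intro norm_differential_weight) auto
    ultimately show ?thesis by simp
  qed
  then have "(\<Sum>j\<in>local_indices N y. norm (differential (weight j) y)) \<le>
      of_nat (card (local_indices N y)) * (4 * (8 + 1024 * M) / 2 powi N)"
    by (intro sum_bounded_above) auto
  also have "\<dots> \<le> (5 * M) * (4 * (8 + 1024 * M) / 2 powi N)"
  proof (rule mult_right_mono)
    show "real (card (local_indices N y)) \<le> 5 * M"
      using local_indices_card(2)[of N y] by linarith
  qed simp
  finally show ?thesis .
qed

definition partition_function :: "int \<times> 'a \<Rightarrow> 'a \<Rightarrow> real" where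
  "partition_function j y = weight j y * inverse (total_weight y)"

lemma total_weight_nonneg: "0 \<le> total_weight y"
  unfolding total_weight_def by (intro sum_nonneg weight_nonneg)

lemma has_derivative_inverse_total_weight:
  assumes "y \<in> - X"
  shows "(inverse has_real_derivative - (inverse (total_weight y))\<^sup>2) (at (total_weight y))"
  using DERIV_inverse[of "total_weight y" UNIV] total_weight_ge_1[OF assms]
  by (simp add: power2_eq_square)

lemma C1_on_inverse_total_weight: "C1_on (- X) (\<lambda>y. inverse (total_weight y))"
proof (rule C1_on_compose[OF C1_on_total_weight has_derivative_inverse_total_weight])
  show "continuous_on (- X) (\<lambda>y. - (inverse (total_weight y))\<^sup>2)"
    using total_weight_ge_1
    by (intro continuous_intros C1_on_continuous[OF C1_on_total_weight]) force
qed

lemma C1_on_partition_function: "j \<in> indices \<Longrightarrow> C1_on (- X) (partition_function j)"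
  unfolding partition_function_def by (intro C1_on_mult C1_on_weight C1_on_inverse_total_weight)

text \<open>
  The quotient rule produces the differentials of the weights and that of the total weight \<open>T\<close>, which
  is their sum. The factors \<open>weight j y / T\<^sup>2\<close> of the latter add up to \<open>1 / T \<le> 1\<close>.
\<close>

lemma sum_norm_differential_partition_function:
  assumes y: "y \<in> - X" and N: "2 powi N \<le> infdist y X" "infdist y X < 2 * 2 powi N"
  shows "(\<Sum>j\<in>local_indices N y. norm (differential (partition_function j) y)) \<le>
    2 * (\<Sum>j\<in>local_indices N y. norm (differential (weight j) y))"
proof -
  let ?T = "total_weight y" and ?K = "local_indices N y"
  have T: "1 \<le> ?T" "0 \<le> inverse ?T" "inverse ?T \<le> 1"
    using total_weight_ge_1[OF y] by (auto simp: inverse_le_1_iff)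
  have dT: "differential (\<lambda>y. inverse (total_weight y)) y =
      - (inverse ?T)\<^sup>2 *\<^sub>R differential total_weight y"
    using differential_compose[OF C1_on_total_weight y has_derivative_inverse_total_weight[OF y]] .
  have "norm (differential (partition_function j) y) \<le>
      weight j y * ((inverse ?T)\<^sup>2 * norm (differential total_weight y)) +
      norm (differential (weight j) y)" if "j \<in> ?K" for j
  proof -
    have "j \<in> indices" using that local_indices_subset by blast
    then have "differential (partition_function j) y =
        weight j y *\<^sub>R differential (\<lambda>y. inverse (total_weight y)) y +
        inverse ?T *\<^sub>R differential (weight j) y"
      unfolding partition_function_def
      by (intro differential_mult[OF C1_on_weight C1_on_inverse_total_weight y])
    then have "norm (differential (partition_function j) y) \<le>
        weight j y * norm (differential (\<lambda>y. inverse (total_weight y)) y) +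
        inverse ?T * norm (differential (weight j) y)"
      using norm_triangle_ineq[of "weight j y *\<^sub>R differential (\<lambda>y. inverse (total_weight y)) y"
          "inverse ?T *\<^sub>R differential (weight j) y"] T(2) weight_nonneg[of j y]
      by simp
    moreover have "inverse ?T * norm (differential (weight j) y) \<le> norm (differential (weight j) y)"
      using T(2,3) by (simp add: mult_left_le_one_le)
    ultimately show ?thesis by (simp add: dT)
  qed
  then have "(\<Sum>j\<in>?K. norm (differential (partition_function j) y)) \<le>
      (\<Sum>j\<in>?K. weight j y * ((inverse ?T)\<^sup>2 * norm (differential total_weight y)) +
      norm (differential (weight j) y))"
    by (rule sum_mono)
  also have "\<dots> = (\<Sum>j\<in>?K. weight j y) * ((inverse ?T)\<^sup>2 * norm (differential total_weight y)) +
      (\<Sum>j\<in>?K. norm (differential (weight j) y))"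
    by (simp add: sum.distrib sum_distrib_right)
  also have "(\<Sum>j\<in>?K. weight j y) = ?T"
    using N by (intro total_weight_local) auto
  also have "?T * ((inverse ?T)\<^sup>2 * norm (differential total_weight y)) =
      inverse ?T * norm (differential total_weight y)"
    using T(1) by (simp add: power2_eq_square)
  also have "\<dots> \<le> norm (differential total_weight y)"
    using T(2,3) by (simp add: mult_left_le_one_le)
  also have "\<dots> \<le> (\<Sum>j\<in>?K. norm (differential (weight j) y))"
    by (rule norm_differential_total_weight[OF y N])
  finally show ?thesis by simp
qed

text \<open>
  The constant: active points are within \<open>17 * 2\<^sup>N\<close> of \<open>y\<close>; at most \<open>5 M\<close> weights are active, each
  with differential at most \<open>4 (8 + 1024 M) / 2\<^sup>N\<close>; the quotient rule doubles their sum, and the distance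
  from \<open>X\<close> is below \<open>2 * 2\<^sup>N\<close>.
\<close>

lemma whitney_partition_of_nets:
  "whitney_partition X indices snd partition_function (17 + 80 * M * (8 + 1024 * M))"
    (is "whitney_partition _ _ _ _ ?C")
  unfolding whitney_partition_def
proof (intro conjI ballI)
  show "0 \<le> ?C" by simp
  show "snd j \<in> X" if "j \<in> indices" for j
    using that net_mem by (auto simp: indices_def)
  show "C1_on (- X) (partition_function j)" if "j \<in> indices" for j
    using that by (rule C1_on_partition_function)
  show "\<forall>y. 0 \<le> partition_function j y" for j
    by (simp add: partition_function_def weight_nonneg total_weight_nonneg)
next
  fix y assume y: "y \<in> - X"
  obtain N where N: "2 powi N \<le> infdist y X" "infdist y X < 2 * 2 powi N"
    using dyadic_scale[OF infdist_pos[OF y]] .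
  let ?K = "local_indices N y" and ?V = "- X \<inter> ball y (2 powi N / 2)"
  have pos: "0 < (2::real) powi N" by simp
  have "partition_function j z = 0" if "z \<in> ?V" "j \<in> indices - ?K" for j z
    using weight_local[OF N, of z j] that by (auto simp: partition_function_def)
  moreover have "(\<Sum>j\<in>?K. partition_function j z) = 1" if "z \<in> ?V" for z
  proof -
    have "(\<Sum>j\<in>?K. partition_function j z) = (\<Sum>j\<in>?K. weight j z) * inverse (total_weight z)"
      by (simp add: partition_function_def sum_distrib_right)
    also have "(\<Sum>j\<in>?K. weight j z) = total_weight z"
      using that by (intro total_weight_local N) simp
    also have "total_weight z * inverse (total_weight z) = 1"
      using total_weight_ge_1[of z] that by simp
    finally show ?thesis .
  qed
  moreover have "dist (snd j) y \<le> ?C * infdist y X" if "j \<in> ?K" for j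
  proof -
    have "dist (snd j) y \<le> 17 * infdist y X"
      using that N(1) by (auto simp: local_indices_def)
    also have "\<dots> \<le> ?C * infdist y X"
      by (intro mult_right_mono infdist_nonneg) simp
    finally show ?thesis .
  qed
  moreover have "(\<Sum>j\<in>?K. norm (differential (partition_function j) y)) * infdist y X \<le> ?C"
  proof -
    have "(\<Sum>j\<in>?K. norm (differential (partition_function j) y)) \<le>
        2 * (5 * M * (4 * (8 + 1024 * M) / 2 powi N))"
      using sum_norm_differential_partition_function[OF y N] sum_norm_differential_weight[OF y, of N]
      by linarith
    then have "(\<Sum>j\<in>?K. norm (differential (partition_function j) y)) * infdist y X \<le>
        2 * (5 * M * (4 * (8 + 1024 * M) / 2 powi N)) * (2 * 2 powi N)"
      using N(2) by (intro mult_mono) (auto simp: infdist_nonneg)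
    also have "\<dots> = 80 * M * (8 + 1024 * M)" by simp
    finally show ?thesis by simp
  qed
  ultimately show "\<exists>K V. finite K \<and> K \<subseteq> indices \<and> open V \<and> y \<in> V \<and> V \<subseteq> - X \<and>
      (\<forall>z\<in>V. (\<forall>j\<in>indices - K. partition_function j z = 0) \<and> (\<Sum>j\<in>K. partition_function j z) = 1) \<and>
      (\<forall>j\<in>K. dist (snd j) y \<le> ?C * infdist y X) \<and>
      (\<Sum>j\<in>K. norm (differential (partition_function j) y)) * infdist y X \<le> ?C"
    using local_indices_card(1) local_indices_subset closed_X y
    by (intro exI[of _ ?K] exI[of _ ?V]) auto
qed

end

proposition whitney_partition_exists:
  fixes X :: "'a::real_normed_vector set"
  assumes "C1_on (UNIV - {0}) (norm :: 'a \<Rightarrow> real)" "closed X" "doubling X" "X \<noteq> {}"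
  obtains J :: "(int \<times> 'a) set" and p v C where "whitney_partition X J p v C"
proof -
  obtain M :: nat where M: "\<And>r s A y. \<lbrakk>A \<subseteq> X; 0 < r; separated r A; s \<le> 2 ^ 8 * r\<rbrakk> \<Longrightarrow>
      finite {x\<in>A. dist x y < s} \<and> card {x\<in>A. dist x y < s} \<le> M"
    using doubling_separated_card[OF assms(3), where k = 8] by blast
  have "\<exists>A\<subseteq>X. separated (2 powi n) A \<and> (\<forall>x\<in>X. \<exists>a\<in>A. dist x a < 2 powi n)" for n :: int
    by (rule maximal_separated_subset) simp
  then obtain A where A: "\<And>n::int. A n \<subseteq> X" "\<And>n. separated (2 powi n) (A n)"
    "\<And>n x. x \<in> X \<Longrightarrow> \<exists>a\<in>A n. dist x a < 2 powi n"
    by metis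
  interpret whitney_nets X A M
  proof
    show "finite {x\<in>A n. dist x y < s}" "card {x\<in>A n. dist x y < s} \<le> M"
      if "s \<le> 2 ^ 8 * 2 powi n" for s n y
      using M[OF A(1)[of n] _ A(2)[of n] that] by simp_all
  qed (fact assms A)+
  show ?thesis using that whitney_partition_of_nets by blast
qed

section \<open>The extension operator\<close>

definition taylor :: "('a::real_normed_vector \<Rightarrow> real) \<Rightarrow> ('a \<Rightarrow> ('a \<Rightarrow>\<^sub>L real)) \<Rightarrow> 'a \<Rightarrow> 'a \<Rightarrow> real" where
  "taylor f L a y = f a + blinfun_apply (L a) (y - a)"

definition whitney_extension ::
  "'a::real_normed_vector set \<Rightarrow> 'j set \<Rightarrow> ('j \<Rightarrow> 'a) \<Rightarrow> ('j \<Rightarrow> 'a \<Rightarrow> real) \<Rightarrow>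
    ('a \<Rightarrow> real) \<Rightarrow> ('a \<Rightarrow> ('a \<Rightarrow>\<^sub>L real)) \<Rightarrow> 'a \<Rightarrow> real" where
  "whitney_extension X J p v f L y =
    (if y \<in> X then f y else (\<Sum>j | j \<in> J \<and> v j y \<noteq> 0. v j y * taylor f L (p j) y))"

text \<open>
  Both polynomials are affine. At \<open>x\<close> they differ by the remainder, and their slopes differ by
  \<open>L x - L a\<close>.
\<close>

lemma taylor_diff: "taylor f L x y - taylor f L a y = remainder f L a x + blinfun_apply (L x - L a) (y - x)"
proof -
  have "L a (y - a) = L a (y - x) + L a (x - a)"
    by (simp flip: blinfun.add_right)
  then show ?thesis
    by (simp add: taylor_def remainder_def blinfun.diff_left)
qed

lemma linear_on_pairs_whitney_extension:
  fixes X :: "'a::real_normed_vector set"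
  assumes "\<And>j. j \<in> J \<Longrightarrow> p j \<in> X"
  shows "linear_on_pairs X (whitney_extension X J p v)"
  unfolding linear_on_pairs_def
proof (intro conjI allI impI)
  fix f f' :: "'a \<Rightarrow> real" and L L' :: "'a \<Rightarrow> 'a \<Rightarrow>\<^sub>L real" and c :: real
  show "whitney_extension X J p v f L = whitney_extension X J p v f' L'"
    if "\<forall>x\<in>X. f x = f' x \<and> L x = L' x"
    using that assms
    by (auto simp: fun_eq_iff whitney_extension_def taylor_def intro!: sum.cong)
  show "whitney_extension X J p v (\<lambda>x. f x + f' x) (\<lambda>x. L x + L' x) =
      (\<lambda>y. whitney_extension X J p v f L y + whitney_extension X J p v f' L' y)"
    by (auto simp: fun_eq_iff whitney_extension_def taylor_def blinfun.add_left algebra_simps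
        simp flip: sum.distrib)
  show "whitney_extension X J p v (\<lambda>x. c * f x) (\<lambda>x. c *\<^sub>R L x) =
      (\<lambda>y. c * whitney_extension X J p v f L y)"
    by (auto simp: fun_eq_iff whitney_extension_def taylor_def blinfun.scaleR_left sum_distrib_left
        algebra_simps)
qed

text \<open>
  The local and uniform form in which the hypotheses on \<open>(f, L)\<close> are used: \<open>\<delta>\<close> is a modulus of
  continuity at \<open>a\<close> for \<open>L\<close> and for the difference quotient of the remainder.
\<close>

definition jet_modulus ::
  "'a::real_normed_vector set \<Rightarrow> ('a \<Rightarrow> real) \<Rightarrow> ('a \<Rightarrow> ('a \<Rightarrow>\<^sub>L real)) \<Rightarrow> real \<Rightarrow> 'a \<Rightarrow> real \<Rightarrow> bool" where
  "jet_modulus X f L \<epsilon> a \<delta> \<longleftrightarrow> (\<forall>x\<in>X \<inter> ball a \<delta>. \<forall>y\<in>X \<inter> ball a \<delta>.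
     \<bar>remainder f L x y\<bar> \<le> \<epsilon> * dist x y \<and> norm (L y - L x) \<le> \<epsilon>)"

lemma admissible_pair_jet_modulus:
  assumes "admissible_pair X f L" "a \<in> X" "0 < \<epsilon>"
  obtains \<delta> where "0 < \<delta>" "jet_modulus X f L \<epsilon> a \<delta>"
proof -
  obtain g :: "'a \<times> 'a \<Rightarrow> real" where g: "continuous_on (X \<times> X) g"
    "\<And>x y. x \<in> X \<Longrightarrow> y \<in> X \<Longrightarrow> x \<noteq> y \<Longrightarrow> g (x, y) = remainder f L x y / norm (y - x)"
    "g (a, a) = 0"
    using assms(1,2) unfolding admissible_pair_def by blast
  obtain d where d: "0 < d"
    "\<And>q. q \<in> X \<times> X \<Longrightarrow> dist q (a, a) < d \<Longrightarrow> dist (g q) (g (a, a)) < \<epsilon>"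
    using g(1) assms(2,3) unfolding continuous_on_iff by (metis SigmaI)
  have "continuous_on X L" using assms(1) by (simp add: admissible_pair_def)
  then obtain d' where d': "0 < d'" "\<And>x. x \<in> X \<Longrightarrow> dist x a < d' \<Longrightarrow> dist (L x) (L a) < \<epsilon> / 2"
    using assms(2,3) unfolding continuous_on_iff by (metis half_gt_zero)
  have "jet_modulus X f L \<epsilon> a (min (d / 2) d')"
    unfolding jet_modulus_def
  proof (intro ballI conjI)
    fix x y assume xy: "x \<in> X \<inter> ball a (min (d / 2) d')" "y \<in> X \<inter> ball a (min (d / 2) d')"
    have "dist (x, y) (a, a) \<le> dist x a + dist y a"
      unfolding dist_Pair_Pair by (rule sqrt_sum_squares_le_sum) simp_all
    then have "dist (x, y) (a, a) < d" using xy by (simp add: dist_commute)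
    then have "\<bar>g (x, y)\<bar> < \<epsilon>" using d(2)[of "(x, y)"] xy g(3) by simp
    then show "\<bar>remainder f L x y\<bar> \<le> \<epsilon> * dist x y"
    proof (cases "x = y")
      case False
      then have "\<bar>remainder f L x y\<bar> / dist x y < \<epsilon>"
        using \<open>\<bar>g (x, y)\<bar> < \<epsilon>\<close> g(2)[of x y] xy by (simp add: dist_norm norm_minus_commute)
      then show ?thesis using False by (simp add: divide_less_eq)
    qed (simp add: remainder_def)
    show "norm (L y - L x) \<le> \<epsilon>"
      using d'(2)[of x] d'(2)[of y] xy dist_triangle2[of "L y" "L x" "L a"]
      by (simp add: dist_commute dist_norm[of "L y" "L x", symmetric])
  qed
  then show ?thesis using that d(1) d'(1) by (metis half_gt_zero min_less_iff_conj)
qed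

lemma jet_modulus_taylor:
  assumes "jet_modulus X f L \<epsilon> a \<delta>" "x \<in> X \<inter> ball a \<delta>" "x' \<in> X \<inter> ball a \<delta>"
  shows "\<bar>taylor f L x y - taylor f L x' y\<bar> \<le> \<epsilon> * (dist x x' + dist x y)"
proof -
  have "norm (L x - L x') \<le> \<epsilon>"
    using assms unfolding jet_modulus_def by blast
  then have "norm (L x - L x') * norm (y - x) \<le> \<epsilon> * dist x y"
    unfolding dist_norm norm_minus_commute[of x y] by (rule mult_right_mono) simp
  then have "\<bar>blinfun_apply (L x - L x') (y - x)\<bar> \<le> \<epsilon> * dist x y"
    using norm_blinfun[of "L x - L x'" "y - x"] by simp
  moreover have "\<bar>remainder f L x' x\<bar> \<le> \<epsilon> * dist x' x"
    using assms unfolding jet_modulus_def by blast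
  ultimately show ?thesis
    unfolding taylor_diff dist_commute[of x x'] distrib_left by linarith
qed

locale whitney_partition_data =
  fixes X :: "'a::real_normed_vector set" and J :: "'j set" and p v C
  assumes closed_X: "closed X" and X_nonempty: "X \<noteq> {}"
    and partition: "whitney_partition X J p v C"
begin

lemma C_nonneg: "0 \<le> C"
  using partition by (simp add: whitney_partition_def)

lemma centre_in_X: "j \<in> J \<Longrightarrow> p j \<in> X"
  and C1_on_v: "j \<in> J \<Longrightarrow> C1_on (- X) (v j)"
  and v_nonneg: "j \<in> J \<Longrightarrow> 0 \<le> v j y"
  using partition by (simp_all add: whitney_partition_def)

lemma local_family:
  assumes "y \<in> - X"
  obtains K V where "finite K" "K \<subseteq> J" "open V" "y \<in> V" "V \<subseteq> - X"
    "\<And>z j. z \<in> V \<Longrightarrow> j \<in> J \<Longrightarrow> j \<notin> K \<Longrightarrow> v j z = 0" "\<And>z. z \<in> V \<Longrightarrow> (\<Sum>j\<in>K. v j z) = 1"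
    "\<And>j. j \<in> K \<Longrightarrow> dist (p j) y \<le> C * infdist y X"
    "(\<Sum>j\<in>K. norm (differential (v j) y)) * infdist y X \<le> C"
proof -
  have "\<exists>K V. finite K \<and> K \<subseteq> J \<and> open V \<and> y \<in> V \<and> V \<subseteq> - X \<and>
        (\<forall>z\<in>V. (\<forall>j\<in>J - K. v j z = 0) \<and> (\<Sum>j\<in>K. v j z) = 1) \<and>
        (\<forall>j\<in>K. dist (p j) y \<le> C * infdist y X) \<and>
        (\<Sum>j\<in>K. norm (differential (v j) y)) * infdist y X \<le> C"
    using partition assms unfolding whitney_partition_def by simp
  then show ?thesis using that by (elim exE conjE) simp
qed

abbreviation extension :: "('a \<Rightarrow> real) \<Rightarrow> ('a \<Rightarrow> ('a \<Rightarrow>\<^sub>L real)) \<Rightarrow> 'a \<Rightarrow> real" where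
  "extension \<equiv> whitney_extension X J p v"

lemma extension_local:
  assumes "finite K" "K \<subseteq> J" "z \<in> - X" "\<And>j. j \<in> J \<Longrightarrow> j \<notin> K \<Longrightarrow> v j z = 0"
  shows "(\<Sum>j\<in>K. v j z * taylor f L (p j) z) = extension f L z"
proof -
  have "(\<Sum>j\<in>K. v j z * taylor f L (p j) z) = (\<Sum>j | j \<in> J \<and> v j z \<noteq> 0. v j z * taylor f L (p j) z)"
    by (rule sum.mono_neutral_right[OF assms(1)]) (use assms(2,4) in auto)
  then show ?thesis using assms(3) by (simp add: whitney_extension_def)
qed

lemma C1_on_v_taylor:
  assumes "j \<in> J"
  shows "C1_on (- X) (\<lambda>z. v j z * taylor f L (p j) z)"
  unfolding taylor_def by (intro C1_on_mult C1_on_v C1_on_affine assms)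

lemma differential_v_taylor:
  assumes "j \<in> J" "y \<in> - X"
  shows "differential (\<lambda>z. v j z * taylor f L (p j) z) y =
    v j y *\<^sub>R L (p j) + taylor f L (p j) y *\<^sub>R differential (v j) y"
  using differential_mult[OF C1_on_v[OF assms(1)] C1_on_affine assms(2), of "f (p j)" "L (p j)" "p j"]
  by (simp add: taylor_def differential_affine)

lemma C1_on_extension: "C1_on (- X) (extension f L)"
proof (rule C1_on_local)
  fix y assume y: "y \<in> - X"
  obtain K V where K: "finite K" "K \<subseteq> J" and V: "open V" "y \<in> V" "V \<subseteq> - X"
    and zero: "\<And>z j. z \<in> V \<Longrightarrow> j \<in> J \<Longrightarrow> j \<notin> K \<Longrightarrow> v j z = 0"
    and one: "\<And>z. z \<in> V \<Longrightarrow> (\<Sum>j\<in>K. v j z) = 1"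
    and near: "\<And>j. j \<in> K \<Longrightarrow> dist (p j) y \<le> C * infdist y X"
    and bound: "(\<Sum>j\<in>K. norm (differential (v j) y)) * infdist y X \<le> C"
    by (rule local_family[OF y], rule that)
  have C1: "C1_on (- X) (\<lambda>z. \<Sum>j\<in>K. v j z * taylor f L (p j) z)"
    using K by (intro C1_on_sum C1_on_v_taylor) auto
  have "C1_on V (extension f L)"
    using V(3) zero
    by (intro C1_on_cong_open[OF C1_on_subset[OF C1 V(3)] V(1)] extension_local K) auto
  then show "\<exists>V. open V \<and> y \<in> V \<and> C1_on V (extension f L)" using V by blast
qed

text \<open>
  The difference is a convex combination of the differences between the Taylor polynomials at \<open>p j\<close>
  and at \<open>a\<close>, where each \<open>p j\<close> is within \<open>(C + 1) * dist y a\<close> of \<open>a\<close>.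
\<close>

lemma extension_value_estimate:
  assumes "jet_modulus X f L \<epsilon> a \<delta>" "a \<in> X" "y \<in> - X" "(C + 1) * dist y a < \<delta>" "0 \<le> \<epsilon>"
  shows "\<bar>extension f L y - taylor f L a y\<bar> \<le> \<epsilon> * (2 * C + 1) * dist y a"
proof -
  obtain K V where K: "finite K" "K \<subseteq> J" and V: "open V" "y \<in> V" "V \<subseteq> - X"
    and zero: "\<And>z j. z \<in> V \<Longrightarrow> j \<in> J \<Longrightarrow> j \<notin> K \<Longrightarrow> v j z = 0"
    and one: "\<And>z. z \<in> V \<Longrightarrow> (\<Sum>j\<in>K. v j z) = 1"
    and near: "\<And>j. j \<in> K \<Longrightarrow> dist (p j) y \<le> C * infdist y X"
    and bound: "(\<Sum>j\<in>K. norm (differential (v j) y)) * infdist y X \<le> C"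
    by (rule local_family[OF assms(3)], rule that)
  have "0 \<le> (C + 1) * dist y a" using C_nonneg by simp
  then have "0 < \<delta>" using assms(4) by linarith
  have d: "C * infdist y X \<le> C * dist y a"
    using infdist_le[OF assms(2)] C_nonneg by (intro mult_left_mono) auto
  have "\<bar>taylor f L (p j) y - taylor f L a y\<bar> \<le> \<epsilon> * (2 * C + 1) * dist y a" if "j \<in> K" for j
  proof -
    have py: "dist (p j) y \<le> C * dist y a" using near[OF that] d by simp
    then have pa: "dist (p j) a \<le> (C + 1) * dist y a"
      using dist_triangle[of "p j" a y] by (simp add: algebra_simps)
    then have "\<bar>taylor f L (p j) y - taylor f L a y\<bar> \<le> \<epsilon> * (dist (p j) a + dist (p j) y)"
      using assms(2,4) \<open>0 < \<delta>\<close> centre_in_X that K(2)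
      by (intro jet_modulus_taylor[OF assms(1)]) (auto simp: dist_commute)
    also have "\<dots> \<le> \<epsilon> * ((C + 1) * dist y a + C * dist y a)"
      using py pa assms(5) by (intro mult_left_mono add_mono) auto
    finally show ?thesis by (simp add: algebra_simps)
  qed
  then have "(\<Sum>j\<in>K. v j y * \<bar>taylor f L (p j) y - taylor f L a y\<bar>) \<le>
      (\<Sum>j\<in>K. v j y * (\<epsilon> * (2 * C + 1) * dist y a))"
    using K(2) v_nonneg by (intro sum_mono mult_left_mono) auto
  also have "\<dots> = \<epsilon> * (2 * C + 1) * dist y a"
    using one[OF V(2)] by (simp flip: sum_distrib_right)
  finally have "(\<Sum>j\<in>K. v j y * \<bar>taylor f L (p j) y - taylor f L a y\<bar>) \<le> \<epsilon> * (2 * C + 1) * dist y a" .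
  moreover have "extension f L y - taylor f L a y =
      (\<Sum>j\<in>K. v j y * (taylor f L (p j) y - taylor f L a y))"
  proof -
    have "(\<Sum>j\<in>K. v j y * taylor f L (p j) y) = extension f L y"
      using zero[OF V(2)] by (rule extension_local[OF K assms(3)])
    moreover have "(\<Sum>j\<in>K. v j y * taylor f L a y) = taylor f L a y"
      using one[OF V(2)] by (simp flip: sum_distrib_right)
    ultimately show ?thesis by (simp add: right_diff_distrib sum_subtractf)
  qed
  moreover have "\<bar>\<Sum>j\<in>K. v j y * (taylor f L (p j) y - taylor f L a y)\<bar> \<le>
      (\<Sum>j\<in>K. v j y * \<bar>taylor f L (p j) y - taylor f L a y\<bar>)"
    using K(2) v_nonneg by (intro order_trans[OF sum_abs] sum_mono) (auto simp: abs_mult)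
  ultimately show ?thesis by linarith
qed

text \<open>
  Since the partition functions add up to the constant \<open>1\<close>, their differentials add up to \<open>0\<close>. So the
  Taylor polynomial at an arbitrary point \<open>b\<close> may be subtracted from all the polynomials in the sum.
\<close>

lemma differential_extension:
  assumes "y \<in> - X"
  obtains K where "K \<subseteq> J" "(\<Sum>j\<in>K. v j y) = 1"
    "\<And>j. j \<in> K \<Longrightarrow> dist (p j) y \<le> C * infdist y X"
    "(\<Sum>j\<in>K. norm (differential (v j) y)) * infdist y X \<le> C"
    "\<And>b. differential (extension f L) y - L b =
      (\<Sum>j\<in>K. v j y *\<^sub>R (L (p j) - L b)) +
      (\<Sum>j\<in>K. (taylor f L (p j) y - taylor f L b y) *\<^sub>R differential (v j) y)"
proof -
  obtain K V where K: "finite K" "K \<subseteq> J" and V: "open V" "y \<in> V" "V \<subseteq> - X"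
    and zero: "\<And>z j. z \<in> V \<Longrightarrow> j \<in> J \<Longrightarrow> j \<notin> K \<Longrightarrow> v j z = 0"
    and one: "\<And>z. z \<in> V \<Longrightarrow> (\<Sum>j\<in>K. v j z) = 1"
    and near: "\<And>j. j \<in> K \<Longrightarrow> dist (p j) y \<le> C * infdist y X"
    and bound: "(\<Sum>j\<in>K. norm (differential (v j) y)) * infdist y X \<le> C"
    by (rule local_family[OF assms], rule that)
  have C1: "C1_on (- X) (\<lambda>z. \<Sum>j\<in>K. v j z * taylor f L (p j) z)"
    using K by (intro C1_on_sum C1_on_v_taylor) auto
  have "differential (extension f L) y = differential (\<lambda>z. \<Sum>j\<in>K. v j z * taylor f L (p j) z) y"
    using V(3) zero
    by (intro differential_cong_open[OF C1_on_subset[OF C1 V(3)] V(1) _ V(2)] extension_local K) auto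
  also have "\<dots> = (\<Sum>j\<in>K. differential (\<lambda>z. v j z * taylor f L (p j) z) y)"
    by (rule differential_sum[OF C1_on_v_taylor assms]) (use K in auto)
  also have "\<dots> = (\<Sum>j\<in>K. v j y *\<^sub>R L (p j) + taylor f L (p j) y *\<^sub>R differential (v j) y)"
    using K(2) assms by (intro sum.cong differential_v_taylor) auto
  finally have dF: "differential (extension f L) y =
      (\<Sum>j\<in>K. v j y *\<^sub>R L (p j)) + (\<Sum>j\<in>K. taylor f L (p j) y *\<^sub>R differential (v j) y)"
    by (simp add: sum.distrib)
  have C1v: "C1_on (- X) (\<lambda>z. \<Sum>j\<in>K. v j z)"
    using K by (intro C1_on_sum C1_on_v) auto
  have "(\<Sum>j\<in>K. differential (v j) y) = differential (\<lambda>z. \<Sum>j\<in>K. v j z) y"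
    by (rule differential_sum[OF C1_on_v assms, symmetric]) (use K in auto)
  also have "\<dots> = differential (\<lambda>_. 1) y"
    using one by (intro differential_cong_open[OF C1_on_subset[OF C1v V(3)] V(1) _ V(2), symmetric]) auto
  finally have sum0: "(\<Sum>j\<in>K. differential (v j) y) = 0" by (simp add: differential_const)
  have "differential (extension f L) y - L b =
      (\<Sum>j\<in>K. v j y *\<^sub>R (L (p j) - L b)) +
      (\<Sum>j\<in>K. (taylor f L (p j) y - taylor f L b y) *\<^sub>R differential (v j) y)" for b
  proof -
    have "(\<Sum>j\<in>K. v j y *\<^sub>R L b) = L b"
      using one[OF V(2)] by (simp flip: scaleR_left.sum)
    moreover have "(\<Sum>j\<in>K. taylor f L b y *\<^sub>R differential (v j) y) = 0"
      using sum0 by (simp flip: scaleR_right.sum)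
    ultimately show ?thesis
      by (simp add: dF scaleR_right_diff_distrib scaleR_left_diff_distrib sum_subtractf)
  qed
  then show ?thesis using that K(2) one[OF V(2)] near bound by blast
qed

text \<open>
  The differentials of the partition are of size \<open>1 / d\<close>, so the Taylor polynomials have to be
  compared to within \<open>O(\<epsilon> d)\<close>. The point \<open>a\<close> may be much further than \<open>d\<close> from \<open>y\<close>; the comparison is
  therefore made with a point \<open>b\<close> of \<open>X\<close> that is nearest to \<open>y\<close> up to a factor \<open>2\<close>, and \<open>L b\<close> is close to
  \<open>L a\<close> by continuity.
\<close>

lemma extension_differential_estimate:
  assumes mod: "jet_modulus X f L \<epsilon> a \<delta>" and a: "a \<in> X" and y: "y \<in> - X"
    and close: "(C + 3) * dist y a < \<delta>" and \<epsilon>: "0 \<le> \<epsilon>"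
  shows "norm (differential (extension f L) y - L a) \<le> \<epsilon> * (2 + 2 * C * (C + 1))"
proof -
  let ?d = "infdist y X"
  obtain K where K: "K \<subseteq> J" and one: "(\<Sum>j\<in>K. v j y) = 1"
    and near: "\<And>j. j \<in> K \<Longrightarrow> dist (p j) y \<le> C * ?d"
    and bound: "(\<Sum>j\<in>K. norm (differential (v j) y)) * ?d \<le> C"
    and dF: "\<And>b. differential (extension f L) y - L b =
      (\<Sum>j\<in>K. v j y *\<^sub>R (L (p j) - L b)) +
      (\<Sum>j\<in>K. (taylor f L (p j) y - taylor f L b y) *\<^sub>R differential (v j) y)"
    using differential_extension[OF y, of f L] by blast
  have d: "0 < ?d" "?d \<le> dist y a"
    using infdist_pos_not_in_closed[OF closed_X X_nonempty] y infdist_le[OF a] by auto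
  have "0 \<le> (C + 3) * dist y a" using C_nonneg by simp
  then have "0 < \<delta>" using close by linarith
  have "\<exists>b\<in>X. dist y b < 2 * ?d"
    using cInf_lessD[of "dist y ` X" "2 * ?d"] d(1) X_nonempty by (auto simp: infdist_notempty)
  then obtain b where b: "b \<in> X" "dist y b < 2 * ?d" by blast
  have Cd: "C * ?d \<le> C * dist y a" using d C_nonneg by (intro mult_left_mono) auto
  have "0 \<le> C * dist y a" using C_nonneg by simp
  have close': "C * dist y a + 3 * dist y a < \<delta>" using close by (simp add: algebra_simps)
  have "dist b a < \<delta>"
    using b(2) d(2) dist_triangle3[of b a y] close' \<open>0 \<le> C * dist y a\<close> by linarith
  then have b': "b \<in> X \<inter> ball a \<delta>" using b(1) by (simp add: dist_commute)
  have p': "p j \<in> X \<inter> ball a \<delta>" if "j \<in> K" for j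
  proof -
    have "dist (p j) a < \<delta>"
      using near[OF that] Cd dist_triangle[of "p j" a y] close' zero_le_dist[of y a] by linarith
    then show ?thesis using that K centre_in_X by (auto simp: dist_commute)
  qed
  have "norm (\<Sum>j\<in>K. v j y *\<^sub>R (L (p j) - L b)) \<le> (\<Sum>j\<in>K. v j y * \<epsilon>)"
  proof (rule sum_norm_le)
    fix j assume j: "j \<in> K"
    have "norm (L (p j) - L b) \<le> \<epsilon>"
      using mod p'[OF j] b' unfolding jet_modulus_def by blast
    then show "norm (v j y *\<^sub>R (L (p j) - L b)) \<le> v j y * \<epsilon>"
      using v_nonneg[of j y] j K by (auto simp: abs_of_nonneg intro!: mult_left_mono)
  qed
  also have "\<dots> = \<epsilon>" using one by (simp flip: sum_distrib_right)
  finally have 1: "norm (\<Sum>j\<in>K. v j y *\<^sub>R (L (p j) - L b)) \<le> \<epsilon>" .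
  have "norm (\<Sum>j\<in>K. (taylor f L (p j) y - taylor f L b y) *\<^sub>R differential (v j) y) \<le>
      (\<Sum>j\<in>K. \<epsilon> * (2 * (C + 1) * ?d) * norm (differential (v j) y))"
  proof (rule sum_norm_le)
    fix j assume j: "j \<in> K"
    have "\<bar>taylor f L (p j) y - taylor f L b y\<bar> \<le> \<epsilon> * (dist (p j) b + dist (p j) y)"
      by (rule jet_modulus_taylor[OF mod p'[OF j] b'])
    also have "\<dots> \<le> \<epsilon> * (2 * (C + 1) * ?d)"
    proof (rule mult_left_mono[OF _ \<epsilon>])
      have "dist (p j) b \<le> C * ?d + 2 * ?d"
        using near[OF j] b(2) dist_triangle[of "p j" b y] by linarith
      then show "dist (p j) b + dist (p j) y \<le> 2 * (C + 1) * ?d"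
        using near[OF j] by (simp add: algebra_simps)
    qed
    finally show "norm ((taylor f L (p j) y - taylor f L b y) *\<^sub>R differential (v j) y) \<le>
        \<epsilon> * (2 * (C + 1) * ?d) * norm (differential (v j) y)"
      by (simp add: mult_right_mono)
  qed
  also have "\<dots> = \<epsilon> * (2 * (C + 1)) * ((\<Sum>j\<in>K. norm (differential (v j) y)) * ?d)"
    unfolding sum_distrib_left[symmetric] by (simp add: mult_ac)
  also have "\<dots> \<le> \<epsilon> * (2 * (C + 1)) * C"
    using bound \<epsilon> C_nonneg by (intro mult_left_mono) auto
  finally have 2: "norm (\<Sum>j\<in>K. (taylor f L (p j) y - taylor f L b y) *\<^sub>R differential (v j) y) \<le>
      \<epsilon> * (2 * (C + 1)) * C" .
  have "a \<in> X \<inter> ball a \<delta>" using a \<open>0 < \<delta>\<close> by simp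
  then have 3: "norm (L b - L a) \<le> \<epsilon>"
    using mod b' unfolding jet_modulus_def by blast
  have "norm (differential (extension f L) y - L b) \<le> \<epsilon> + \<epsilon> * (2 * (C + 1)) * C"
    unfolding dF using norm_triangle_mono[OF 1 2] .
  from norm_triangle_mono[OF this 3]
  have "norm (differential (extension f L) y - L a) \<le> \<epsilon> + \<epsilon> * (2 * (C + 1)) * C + \<epsilon>"
    by simp
  then show ?thesis by (simp add: algebra_simps)
qed

lemma extension_has_derivative_at_X:
  assumes adm: "admissible_pair X f L" and a: "a \<in> X"
  shows "(extension f L has_derivative blinfun_apply (L a)) (at a)"
  unfolding has_derivative_at_alt
proof (intro conjI allI impI)
  show "bounded_linear (blinfun_apply (L a))" by (rule blinfun.bounded_linear_right)
  fix e :: real assume "0 < e"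
  define \<epsilon> where "\<epsilon> = e / (2 * C + 1)"
  have \<epsilon>: "0 < \<epsilon>" "\<epsilon> * (2 * C + 1) = e" "\<epsilon> \<le> e"
    using \<open>0 < e\<close> C_nonneg by (auto simp: \<epsilon>_def divide_le_eq)
  obtain \<delta> where \<delta>: "0 < \<delta>" and mod: "jet_modulus X f L \<epsilon> a \<delta>"
    using admissible_pair_jet_modulus[OF adm a \<epsilon>(1)] .
  have "norm (extension f L y - extension f L a - L a (y - a)) \<le> e * norm (y - a)"
    if y: "norm (y - a) < \<delta> / (C + 1)" for y
  proof -
    have close: "(C + 1) * dist y a < \<delta>"
      using y C_nonneg by (simp add: dist_norm pos_less_divide_eq mult.commute)
    moreover have "0 \<le> C * dist y a" using C_nonneg by simp
    ultimately have "dist y a < \<delta>" by (simp add: algebra_simps)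
    have "extension f L y - extension f L a - L a (y - a) = extension f L y - taylor f L a y"
      using a by (simp add: whitney_extension_def taylor_def)
    also have "\<bar>\<dots>\<bar> \<le> e * dist y a"
    proof (cases "y \<in> X")
      case True
      have "\<bar>remainder f L a y\<bar> \<le> \<epsilon> * dist a y"
        using mod True a \<delta> \<open>dist y a < \<delta>\<close> unfolding jet_modulus_def by (simp add: dist_commute)
      also have "\<dots> \<le> e * dist a y" using \<epsilon>(3) by (intro mult_right_mono) auto
      finally show ?thesis
        using True by (simp add: whitney_extension_def taylor_def remainder_def dist_commute algebra_simps)
    next
      case False
      then show ?thesis
        using extension_value_estimate[OF mod a _ close] \<epsilon> by simp
    qed
    finally show ?thesis by (simp add: dist_norm)
  qed
  then show "\<exists>d>0. \<forall>y. norm (y - a) < d \<longrightarrow>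
      norm (extension f L y - extension f L a - L a (y - a)) \<le> e * norm (y - a)"
    using \<delta> C_nonneg by (intro exI[of _ "\<delta> / (C + 1)"]) auto
qed

lemma extension_differential_continuous_at_X:
  assumes adm: "admissible_pair X f L" and a: "a \<in> X"
  shows "isCont (differential (extension f L)) a"
  unfolding continuous_at_eps_delta
proof (intro allI impI)
  fix e :: real assume "0 < e"
  have dX: "differential (extension f L) x = L x" if "x \<in> X" for x
    using extension_has_derivative_at_X[OF adm that] by (rule differential_eqI)
  define B where "B = 2 + 2 * C * (C + 1)"
  have "2 \<le> B" using C_nonneg by (simp add: B_def)
  define \<epsilon> where "\<epsilon> = e / (2 * B)"
  have \<epsilon>: "0 < \<epsilon>" "\<epsilon> * B < e" "\<epsilon> < e"
    using \<open>0 < e\<close> \<open>2 \<le> B\<close> by (auto simp: \<epsilon>_def field_simps)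
  obtain \<delta> where \<delta>: "0 < \<delta>" and mod: "jet_modulus X f L \<epsilon> a \<delta>"
    using admissible_pair_jet_modulus[OF adm a \<epsilon>(1)] .
  have "dist (differential (extension f L) y) (differential (extension f L) a) < e"
    if y: "dist y a < \<delta> / (C + 3)" for y
  proof -
    have close: "(C + 3) * dist y a < \<delta>"
      using y C_nonneg by (simp add: pos_less_divide_eq mult.commute)
    moreover have "0 \<le> C * dist y a" using C_nonneg by simp
    moreover have "0 \<le> dist y a" by simp
    ultimately have "dist y a < \<delta>" unfolding distrib_right by linarith
    show ?thesis
    proof (cases "y \<in> X")
      case True
      then have "norm (L y - L a) \<le> \<epsilon>"
        using mod a \<delta> \<open>dist y a < \<delta>\<close> unfolding jet_modulus_def by (simp add: dist_commute)
      then show ?thesis using \<epsilon>(3) by (simp add: dX[OF True] dX[OF a] dist_norm)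
    next
      case False
      then have "norm (differential (extension f L) y - L a) \<le> \<epsilon> * B"
        using extension_differential_estimate[OF mod a _ close] \<epsilon>(1) by (simp add: B_def)
      then show ?thesis using \<epsilon>(2) by (simp add: dX[OF a] dist_norm)
    qed
  qed
  then show "\<exists>d>0. \<forall>y. dist y a < d \<longrightarrow>
      dist (differential (extension f L) y) (differential (extension f L) a) < e"
    using \<delta> C_nonneg by (intro exI[of _ "\<delta> / (C + 3)"]) auto
qed

lemma C1_extension_extension:
  assumes adm: "admissible_pair X f L"
  shows "C1_extension X f L (extension f L)"
  unfolding C1_extension_def
proof (intro conjI ballI)
  show "extension f L x = f x" if "x \<in> X" for x
    using that by (simp add: whitney_extension_def)
  show "(extension f L has_derivative blinfun_apply (L x)) (at x)" if "x \<in> X" for x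
    using extension_has_derivative_at_X[OF adm that] .
  show "C1_on UNIV (extension f L)"
  proof (rule C1_onI)
    show "(extension f L has_derivative blinfun_apply (differential (extension f L) y)) (at y)" for y
    proof (cases "y \<in> X")
      case True
      have *: "(extension f L has_derivative blinfun_apply (L y)) (at y)"
        by (rule extension_has_derivative_at_X[OF adm True])
      then show ?thesis unfolding differential_eqI[OF *] .
    next
      case False
      then show ?thesis by (intro C1_on_has_differential[OF C1_on_extension]) simp
    qed
    have "isCont (differential (extension f L)) y" for y
    proof (cases "y \<in> X")
      case True
      then show ?thesis by (rule extension_differential_continuous_at_X[OF adm])
    next
      case False
      have "open (- X)" using closed_X by auto
      then show ?thesis
        using C1_on_continuous_differential[OF C1_on_extension, of f L] False
        by (simp add: continuous_on_eq_continuous_at)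
    qed
    then show "continuous_on UNIV (differential (extension f L))"
      by (simp add: continuous_at_imp_continuous_on)
  qed
qed

end

theorem theorem4p3:
  fixes X :: "'a::banach set"
  assumes "C1_on (UNIV - {0}) (norm :: 'a \<Rightarrow> real)"
    and "closed X"
    and "doubling X"
  shows "(\<forall>f L. admissible_pair X f L \<longrightarrow> (\<exists>F. C1_extension X f L F)) \<and>
    (\<exists>E. linear_on_pairs X E \<and>
      (\<forall>f L. admissible_pair X f L \<longrightarrow> C1_extension X f L (E f L)))"
proof -
  have "\<exists>E. linear_on_pairs X E \<and>
      (\<forall>f L. admissible_pair X f L \<longrightarrow> C1_extension X f L (E f L))"
  proof (cases "X = {}")
    case True
    \<comment> \<open>there is no point to measure the distance from, but zero is an extension\<close>
    have "C1_on UNIV (\<lambda>_ :: 'a. 0)"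
      using C1_on_affine[of UNIV 0 0 0] by simp
    then show ?thesis
      using True
      by (intro exI[of _ "\<lambda>_ _ _. 0"]) (simp add: linear_on_pairs_def C1_extension_def)
  next
    case False
    obtain J :: "(int \<times> 'a) set" and p v C where "whitney_partition X J p v C"
      using whitney_partition_exists[OF assms False] .
    then interpret whitney_partition_data X J p v C
      using assms(2) False by unfold_locales
    show ?thesis
      by (intro exI[of _ extension] conjI allI impI linear_on_pairs_whitney_extension
          C1_extension_extension centre_in_X)
  qed
  then obtain E where E: "linear_on_pairs X E"
    "\<forall>f L. admissible_pair X f L \<longrightarrow> C1_extension X f L (E f L)"
    by (elim exE conjE) (rule that)
  show ?thesis
  proof (intro conjI allI impI)
    show "\<exists>F. C1_extension X f L F" if "admissible_pair X f L" for f L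
      using E(2) that by (intro exI[of _ "E f L"]) simp
    show "\<exists>E. linear_on_pairs X E \<and>
        (\<forall>f L. admissible_pair X f L \<longrightarrow> C1_extension X f L (E f L))"
      using E by (intro exI[of _ E] conjI)
  qed
qed

end
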